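(* For every integer $d\geq 1$ there are constants $C_d>0$ and $p_0=p_0(d)$, depending only on $d$, such that the following holds for every prime $p\geq p_0$. Let $\Gamma$ be a set of $d$ integers. Then there is an integer $x$ with $1<x<p$ whose residue class generates the multiplicative group $\mathbb{F}_p^\times$ and such that $$\max_{r\in\Gamma}\left\|x\frac{r}{p}\right\|\leq C_d\,\frac{p^{1/(2d)}\log p}{\phi(p-1)^{1/d}}.$$
   Context: For real $\theta$, $\|\theta\|$ denotes the distance from $\theta$ to the nearest integer. $\mathbb{F}_p$ is the field with $p$ elements and $\phi$ is Euler's totient function. The paper writes the conclusion as $\ll_d$, where $X\ll_d Y$ means that $X\leq cY$ for a constant $c$ depending only on $d$, once $p$ is sufficiently large. *)

theory Defs
  imports "HOL-Analysis.Analysis" "HOL-Number_Theory.Number_Theory" "HOL-Algebra.Generated_Groups"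
begin

abbreviation dist_int :: "real \<Rightarrow> real" where
  "dist_int \<theta> \<equiv> infdist \<theta> \<int>"

text \<open>
  The residue ring modulo \<open>p\<close> is carried by the integers from \<open>0\<close> to \<open>p - 1\<close>, so
  the residue class of \<open>x\<close> is represented by \<open>x mod p\<close>.
\<close>

definition generates_Fp_units :: "nat \<Rightarrow> int \<Rightarrow> bool" where
  "generates_Fp_units p x \<longleftrightarrow>
     generate (mult_of (residue_ring (int p))) {x mod int p} =
       carrier (mult_of (residue_ring (int p)))"

end

theory Submission
  imports Defs
begin

text \<open>
  Let \<open>B(R)\<close> be the Bohr set of those residues \<open>x\<close> for which every \<open>x r\<close> with \<open>r \<in> \<Gamma>\<close> is
  congruent modulo \<open>p\<close> to an integer of absolute value at most \<open>R\<close>, and let \<open>R\<close> be about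
  \<open>p^(1 - 1/(2 d))\<close>, so that \<open>B(R)\<close> has about \<open>\<surd>p\<close> elements by the pigeonhole principle. At this
  size the bound for a character sum over \<open>B(R)\<close> obtained from Gauss sums is trivial. Burgess' method
  of shifts beats it by a power of \<open>p\<close>: one counts the primitive roots \<open>y + u v\<close> with
  \<open>y \<in> B(R)\<close>, with \<open>u\<close> in the interval of integers from \<open>H^2 + 1\<close> to \<open>H^2 + H\<close> for a small
  power \<open>H\<close> of \<open>p\<close>, and with \<open>v \<in> B(R / (2 H^2))\<close>. As \<open>y + u v = u (y / u + v)\<close>, Hoelder's
  inequality reduces the relevant character sums to the multiplicative energy of \<open>B(R)\<close> and the
  integers \<open>u\<close>, and to a complete fourth moment of \<open>\<chi>(x + v)\<close> summed over \<open>v\<close>.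

  The energy is small because distinct integers \<open>u\<close> have a large quotient by their greatest common
  divisor, which forces solutions of \<open>y u' = y' u\<close> into the Bohr set \<open>B(R / H)\<close>; disjoint translates
  of the latter fit into \<open>B(R)\<close>. Averaged over all characters of order dividing \<open>k\<close>, the fourth
  moment counts the \<open>x\<close> for which a ratio of two quadratics in \<open>x\<close> is a \<open>k\<close>-th power. Stepanov's
  method bounds this number by \<open>p / k + O(\<surd>p)\<close> uniformly in \<open>k\<close>. The saving of a power of \<open>p\<close>
  absorbs the \<open>2^\<omega>(p - 1)\<close> terms of the inclusion-exclusion over the prime factors of \<open>p - 1\<close>.
\<close>

section \<open>Stepanov's method\<close>

text \<open>Pigeonhole stands in for linear algebra over the field: there are
  \<open>p ^ card I\<close> reduced coefficient vectors but only \<open>p ^ card C\<close> value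
  vectors, so two of the former collide and their difference is the required vector.\<close>

lemma nontrivial_kernel_mod:
  fixes a :: "'i \<Rightarrow> 'c \<Rightarrow> int" and p :: nat
  assumes p: "p > 1" and I: "finite I" and C: "finite C" and lt: "card C < card I"
  shows "\<exists>r. (\<exists>i\<in>I. \<not> int p dvd r i) \<and> (\<forall>c\<in>C. int p dvd (\<Sum>i\<in>I. r i * a i c))"
proof -
  define F where "F = PiE I (\<lambda>_. {0..<int p})"
  define G where "G = PiE C (\<lambda>_. {0..<int p})"
  define T where "T = (\<lambda>r. \<lambda>c\<in>C. (\<Sum>i\<in>I. r i * a i c) mod int p)"
  have "T ` F \<subseteq> G"
    using p by (auto simp: T_def G_def)
  moreover have "finite G" using C by (simp add: G_def finite_PiE)
  ultimately have "card (T ` F) \<le> card G" by (rule card_mono[rotated])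
  also have "\<dots> = p ^ card C" by (simp add: G_def card_PiE C)
  also have "\<dots> < p ^ card I" using p lt by simp
  also have "\<dots> = card F" by (simp add: F_def card_PiE I)
  finally have "\<not> inj_on T F" by (rule pigeonhole)
  then obtain r s where rs: "r \<in> F" "s \<in> F" "r \<noteq> s" "T r = T s"
    by (auto simp: inj_on_def)
  then obtain i where i: "i \<in> I" "r i \<noteq> s i"
    unfolding F_def by (metis PiE_ext)
  have bd: "0 \<le> r i" "r i < int p" "0 \<le> s i" "s i < int p"
    using rs i by (auto simp: F_def PiE_iff)
  have "\<not> int p dvd r i - s i"
  proof
    assume "int p dvd r i - s i"
    then have "r i mod int p = s i mod int p" by (simp add: mod_eq_dvd_iff)
    then show False using bd i by simp
  qed
  moreover have "int p dvd (\<Sum>i\<in>I. (r i - s i) * a i c)" if "c \<in> C" for c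
  proof -
    have "T r c = T s c" using rs by simp
    then have "int p dvd (\<Sum>i\<in>I. r i * a i c) - (\<Sum>i\<in>I. s i * a i c)"
      using that by (simp add: T_def mod_eq_dvd_iff)
    then show ?thesis by (simp add: sum_subtractf left_diff_distrib)
  qed
  ultimately show ?thesis using i by (intro exI[of _ "\<lambda>i. r i - s i"]) auto
qed

text \<open>Leibniz' rule, in which only the first derivative of the linear factor survives. At
  \<open>l = 0\<close> the truncated exponent \<open>l - 1\<close> is harmless, since its
  coefficient is zero.\<close>

lemma higher_pderiv_linear_mult:
  fixes q :: "int poly"
  shows "(pderiv ^^ l) ([:- a, 1:] * q) =
    [:- a, 1:] * (pderiv ^^ l) q + of_nat l * (pderiv ^^ (l - 1)) q"
proof (induction l)
  case (Suc l)
  have "(pderiv ^^ Suc l) ([:- a, 1:] * q) =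
     pderiv ([:- a, 1:] * (pderiv ^^ l) q + of_nat l * (pderiv ^^ (l - 1)) q)"
    using Suc by simp
  also have "\<dots> = [:- a, 1:] * (pderiv ^^ Suc l) q + (pderiv ^^ l) q
      + of_nat l * pderiv ((pderiv ^^ (l - 1)) q)"
    by (simp add: pderiv_add pderiv_mult pderiv_pCons pderiv_of_nat pderiv_diff pderiv_smult)
  also have "of_nat l * pderiv ((pderiv ^^ (l - 1)) q) = of_nat l * (pderiv ^^ l) q"
    by (cases l) auto
  finally show ?case by (simp add: algebra_simps)
qed simp

lemma higher_pderiv_add_const:
  fixes q :: "int poly"
  shows "l > 0 \<Longrightarrow> (pderiv ^^ l) (q + [:c:]) = (pderiv ^^ l) q"
  by (induction l rule: nat_induct_non_zero) (auto simp: pderiv_add pderiv_pCons)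

lemma const_dvd_poly:
  fixes f :: "int poly"
  assumes "[:c:] dvd f"
  shows "c dvd poly f x"
  using assms by (auto elim!: dvdE)

text \<open>Synthetic division by \<open>X - a\<close> lowers the multiplicity at \<open>a\<close>
  by one and keeps the others, because the remainder \<open>poly h a\<close> is divisible by
  \<open>p\<close>. Induction on the degree then counts zeros as over a field, while all polynomials
  stay integral.\<close>

lemma sum_multiplicities_mod_le_degree:
  fixes h :: "int poly" and p :: nat and \<mu> :: "int \<Rightarrow> nat"
  assumes "prime p" and "finite S"
    and "\<And>a b. a \<in> S \<Longrightarrow> b \<in> S \<Longrightarrow> a \<noteq> b \<Longrightarrow> \<not> int p dvd a - b"
    and "\<And>a. a \<in> S \<Longrightarrow> \<mu> a \<le> p"
    and "\<And>a l. a \<in> S \<Longrightarrow> l < \<mu> a \<Longrightarrow> int p dvd poly ((pderiv ^^ l) h) a"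
    and "\<not> [:int p:] dvd h"
  shows "sum \<mu> S \<le> degree h"
  using assms(4-)
proof (induction "degree h" arbitrary: h \<mu> rule: less_induct)
  case less
  show ?case
  proof (cases "\<exists>a\<in>S. \<mu> a > 0")
    case False
    then show ?thesis by simp
  next
    case True
    then obtain a where a: "a \<in> S" "\<mu> a > 0" by auto
    have root: "int p dvd poly h a" using less.prems(2)[of a 0] a by simp
    define q where "q = synthetic_div h a"
    have h: "h = [:- a, 1:] * q + [:poly h a:]"
      by (simp only: q_def synthetic_div_correct')
    have nq: "\<not> [:int p:] dvd q"
    proof
      assume "[:int p:] dvd q"
      moreover have "[:int p:] dvd [:poly h a:]" using root by simp
      ultimately have "[:int p:] dvd [:- a, 1:] * q + [:poly h a:]" by (intro dvd_add dvd_mult)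
      then show False using h less.prems(3) by simp
    qed
    have "q \<noteq> 0" using nq by auto
    then have deg: "degree h > 0"
      by (auto simp: q_def synthetic_div_eq_0_iff)
    have degq: "degree q = degree h - 1" by (simp add: q_def degree_synthetic_div)
    define \<nu> where "\<nu> = \<mu>(a := \<mu> a - 1)"
    have deriv: "(pderiv ^^ l) h = [:- a, 1:] * (pderiv ^^ l) q + of_nat l * (pderiv ^^ (l - 1)) q"
      if "l > 0" for l
      using that by (subst h) (simp only: higher_pderiv_add_const higher_pderiv_linear_mult)
    have pint: "prime (int p)" using assms(1) by simp
    have "sum \<nu> S \<le> degree q"
    proof (rule less.hyps)
      show "degree q < degree h" using deg degq by simp
      show "\<nu> b \<le> p" if "b \<in> S" for b
        using less.prems(1)[OF that] by (auto simp: \<nu>_def)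
      show "\<not> [:int p:] dvd q" by (fact nq)
      show "int p dvd poly ((pderiv ^^ l) q) b" if b: "b \<in> S" and l: "l < \<nu> b" for b l
      proof (cases "b = a")
        case True
        have "Suc l < \<mu> a" using l True by (simp add: \<nu>_def)
        then have "int p dvd poly ((pderiv ^^ Suc l) h) a" using less.prems(2)[OF a(1)] by blast
        then have "int p dvd int (Suc l) * poly ((pderiv ^^ l) q) a"
          by (subst (asm) deriv) (simp_all add: of_nat_poly)
        \<comment> \<open>Ordinary derivatives carry factorials, so \<open>Suc l\<close> has to be
          invertible modulo \<open>p\<close>; the bound \<open>\<mu> a \<le> p\<close> ensures
          this.\<close>
        moreover have "\<not> int p dvd int (Suc l)"
          using \<open>Suc l < \<mu> a\<close> less.prems(1)[OF a(1)] by (auto dest!: zdvd_imp_le)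
        ultimately show ?thesis using pint True prime_dvd_multD by blast
      next
        case False
        then have "l < \<mu> b" using l by (simp add: \<nu>_def)
        \<comment> \<open>As \<open>b - a\<close> is invertible modulo \<open>p\<close>, the product
          rule passes the vanishing from \<open>h\<close> to \<open>q\<close> one derivative at a
          time.\<close>
        then show ?thesis
        proof (induction l)
          case 0
          have "int p dvd poly h b" using less.prems(2)[OF b, of 0] 0 by simp
          moreover have "poly h b = (b - a) * poly q b + poly h a"
            using arg_cong[OF h, of "\<lambda>f. poly f b"] by (simp add: algebra_simps)
          ultimately have "int p dvd (b - a) * poly q b"
            using root by (metis dvd_add_left_iff)
          then show ?case using pint assms(3)[OF b a(1) False] prime_dvd_multD
            by (metis funpow_0)
        next
          case (Suc l)
          have "int p dvd poly ((pderiv ^^ Suc l) h) b" using less.prems(2)[OF b] Suc.prems by blast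
          moreover have "poly ((pderiv ^^ Suc l) h) b =
             (b - a) * poly ((pderiv ^^ Suc l) q) b + int (Suc l) * poly ((pderiv ^^ l) q) b"
            by (subst deriv) (simp_all add: of_nat_poly algebra_simps)
          ultimately have "int p dvd (b - a) * poly ((pderiv ^^ Suc l) q) b"
            using Suc by (metis Suc_lessD dvd_add_left_iff dvd_mult)
          then show ?case using pint assms(3)[OF b a(1) False] prime_dvd_multD by blast
        qed
      qed
    qed
    moreover have "sum \<mu> S = sum \<nu> S + 1"
      using a assms(2) by (simp add: \<nu>_def sum.remove[of S a])
    ultimately show ?thesis using degq deg by simp
  qed
qed

section \<open>Higher derivatives of products of powers\<close>

lemma mult_pderiv_power:
  fixes f :: "int poly"
  shows "f * pderiv (f ^ n) = of_nat n * pderiv f * f ^ n"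
proof (cases n)
  case (Suc k)
  have "pderiv (f ^ n) = Polynomial.smult (int n) (f ^ k) * pderiv f"
    unfolding Suc by (rule pderiv_power_Suc)
  then show ?thesis by (simp add: Suc of_nat_poly algebra_simps)
qed simp

text \<open>\<open>A\<close> has logarithmic derivative \<open>L / W\<close>. Each differentiation
  costs one factor \<open>W\<close> and raises the degree of the cofactor of \<open>A\<close> by at
  most 3, however large the degree of \<open>A\<close> is. This keeps the linear conditions in
  Stepanov's method few.\<close>

lemma weighted_higher_pderiv:
  fixes A W L g :: "int poly"
  assumes "W * pderiv A = L * A" and "degree W \<le> 4" and "degree L \<le> 3"
  shows "\<exists>G. degree G \<le> degree g + 3 * l \<and> W ^ l * (pderiv ^^ l) (g * A) = G * A"
proof (induction l)
  case 0
  show ?case by (intro exI[of _ g]) auto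
next
  case (Suc l)
  define F where "F = (pderiv ^^ l) (g * A)"
  from Suc obtain G where G: "degree G \<le> degree g + 3 * l" "W ^ l * F = G * A"
    unfolding F_def by blast
  \<comment> \<open>The last term comes from differentiating \<open>W ^ l\<close> in the product
    \<open>W ^ l * F\<close>.\<close>
  define G' where "G' = W * pderiv G + G * L - of_nat l * pderiv W * G"
  have "W * pderiv (W ^ l * F) = W ^ Suc l * pderiv F + of_nat l * pderiv W * (W ^ l * F)"
    using mult_pderiv_power[of W l] by (simp add: pderiv_mult algebra_simps)
  moreover have "W * pderiv (G * A) = W * pderiv G * A + G * L * A"
    using assms(1) by (simp add: pderiv_mult algebra_simps)
  ultimately have "W ^ Suc l * pderiv F = G' * A"
    unfolding G'_def G(2) by (simp add: algebra_simps)
  moreover have "degree G' \<le> degree g + 3 * Suc l"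
  proof -
    have "degree (W * pderiv G) \<le> degree G + 3"
    proof (cases "degree G = 0")
      case True
      then have "pderiv G = 0" by (simp add: pderiv_eq_0_iff)
      then show ?thesis by simp
    next
      case False
      then show ?thesis
        using degree_mult_le[of W "pderiv G"] assms(2) by (simp add: degree_pderiv)
    qed
    moreover have "degree (G * L) \<le> degree G + 3"
      using degree_mult_le[of G L] assms(3) by simp
    moreover have "degree (of_nat l * pderiv W * G) \<le> degree G + 3"
      using degree_mult_le[of "of_nat l * pderiv W" G] degree_mult_le[of "of_nat l" "pderiv W"] assms(2)
      by (simp add: degree_pderiv)
    ultimately have "degree G' \<le> degree G + 3"
      unfolding G'_def by (intro degree_diff_le degree_add_le)
    then show ?thesis using G(1) by simp
  qed
  ultimately show ?case unfolding F_def by (intro exI[of _ G']) auto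
qed

text \<open>Since \<open>t + i * m\<close> stays below \<open>k * m < p\<close>, the digit
  \<open>j\<close> is the quotient by \<open>p\<close>, and then \<open>i\<close> is the quotient of
  the rest by \<open>m\<close>.\<close>

lemma mixed_radix_inj:
  fixes p k m :: nat
  assumes "k * m < p"
  shows "inj_on (\<lambda>(i, j, t). t + i * m + p * j) ({..<k} \<times> {..<J} \<times> {..<m})"
proof (rule inj_onI, clarsimp)
  fix i j t i' j' t'
  assume lt: "i < k" "i' < k" "t < m" "t' < m" and eq: "t + i * m + p * j = t' + i' * m + p * j'"
  have small: "s + u * m < p" if "u < k" "s < m" for s u
  proof -
    have "s + u * m < Suc u * m" using that by simp
    also have "\<dots> \<le> k * m" using that by (intro mult_le_mono) auto
    finally show ?thesis using assms by simp
  qed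
  have "j = (t + i * m + p * j) div p" using small[of i t] lt by simp
  also have "\<dots> = j'" unfolding eq using small[of i' t'] lt by simp
  finally have "j = j'" .
  then have eq: "t + i * m = t' + i' * m" using eq by simp
  have "i = (t + i * m) div m" using lt by simp
  also have "\<dots> = i'" unfolding eq using lt by simp
  finally show "i = i' \<and> j = j' \<and> t = t'" using eq \<open>j = j'\<close> by simp
qed

lemma fermat_int:
  assumes "prime p"
  shows "[x ^ p = x] (mod int p)"
proof (cases "int p dvd x")
  case True
  then have "int p dvd x ^ p" using assms by (simp add: dvd_power_same prime_gt_0_nat dvd_trans[OF _ dvd_power])
  with True show ?thesis by (simp add: cong_iff_dvd_diff)
next
  case False
  define y where "y = nat (x mod int p)"
  have p: "p > 0" using assms by (simp add: prime_gt_0_nat)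
  have y: "[int y = x] (mod int p)" using p by (simp add: y_def)
  then have "\<not> p dvd y" using False by (metis cong_dvd_iff int_dvd_int_iff)
  then have "[y ^ (p - 1) = 1] (mod p)" using assms fermat_theorem by blast
  then have "[int y ^ (p - 1) = 1] (mod int p)" by (metis cong_int_iff of_nat_1 of_nat_power)
  then have "[x ^ (p - 1) * x = 1 * x] (mod int p)"
    using y by (metis cong_pow cong_refl cong_mult cong_sym cong_trans)
  then show ?thesis using power_minus_mult[OF p, of x] by simp
qed

text \<open>When \<open>k * m = p - 1\<close>, the nonzero \<open>k\<close>-th powers are the
  residues with \<open>m\<close>-th power 1. So these are the points where the ratio of the two
  quadratics is a nonzero \<open>k\<close>-th power, with the denominator cleared.\<close>

definition quadratic_ratio_set :: "nat \<Rightarrow> nat \<Rightarrow> int \<Rightarrow> int \<Rightarrow> int \<Rightarrow> int set" where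
  "quadratic_ratio_set p m b c e = {x \<in> {0..<int p}. \<not> int p dvd x \<and> \<not> int p dvd x + b \<and>
     \<not> int p dvd x + c \<and> \<not> int p dvd x + e \<and>
     [(x * (x + b)) ^ m = ((x + c) * (x + e)) ^ m] (mod int p)}"

text \<open>
  Stepanov's auxiliary polynomial is \<open>h = \<Sum> r(i, j, t) x^t P^(i m) Q^((k - 1 - i) m) x^(p j)\<close> with \<open>P = x (x + b)\<close> and
  \<open>Q = (x + c) (x + e)\<close>. At a point of the set \<open>P^m = Q^m\<close> and \<open>x^p = x\<close>, so the vanishing of a
  derivative of \<open>h\<close> becomes the vanishing of a polynomial of low degree. It is nonzero because the
  terms have pairwise distinct orders \<open>t + i m + p j\<close> at \<open>0\<close>.
\<close>

lemma card_quadratic_ratio_set_mult_le: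
  fixes p k m M J :: nat and b c e :: int
  assumes p: "prime p" and km: "k * m = p - 1"
    and b: "\<not> int p dvd b" and c: "\<not> int p dvd c" and e: "\<not> int p dvd e"
    and M: "M \<le> p" and lt: "M * (m + 3 * M + J) < k * (J * m)"
  shows "card (quadratic_ratio_set p m b c e) * M \<le> m + 2 * (k - 1) * m + p * J - p"
proof -
  define S where "S = quadratic_ratio_set p m b c e"
  define P where "P = [:0, b, 1:]"
  define Q where "Q = [:c * e, c + e, 1:]"
  define R where "R = [:b, 1:]"
  define X where "X = [:0, 1::int:]"
  define W where "W = P * Q"
  define A where "A = (\<lambda>i j. P ^ (i * m) * Q ^ ((k - 1 - i) * m) * X ^ (p * j))"
  define L where "L = (\<lambda>i j. of_nat (i * m) * pderiv P * Q + of_nat ((k - 1 - i) * m) * pderiv Q * P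
     + of_nat (p * j) * (R * Q))"
  have PXR: "P = X * R" by (simp add: P_def X_def R_def)
  have pint: "prime (int p)" using p by simp
  have pgt: "p > 1" using p by (rule prime_gt_1_nat)
  \<comment> \<open>Because \<open>P = X * R\<close>, the single weight \<open>W = P * Q\<close>
    clears the denominators of the logarithmic derivatives of all three powers in
    \<open>A i j\<close>.\<close>
  have dA: "W * pderiv (A i j) = L i j * A i j" for i j
  proof -
    define \<alpha> \<beta> \<gamma> where "\<alpha> = i * m" and "\<beta> = (k - 1 - i) * m" and "\<gamma> = p * j"
    have "W * pderiv (A i j) = (P * pderiv (P ^ \<alpha>)) * (Q * Q ^ \<beta> * X ^ \<gamma>)
      + (Q * pderiv (Q ^ \<beta>)) * (P * P ^ \<alpha> * X ^ \<gamma>) + (P * pderiv (X ^ \<gamma>)) * (Q * P ^ \<alpha> * Q ^ \<beta>)"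
      unfolding A_def \<alpha>_def[symmetric] \<beta>_def[symmetric] \<gamma>_def[symmetric] W_def
      by (simp add: pderiv_mult algebra_simps)
    also have "P * pderiv (X ^ \<gamma>) = R * (of_nat \<gamma> * X ^ \<gamma>)"
      using mult_pderiv_power[of X \<gamma>] unfolding PXR
      by (simp add: mult_ac) (simp add: X_def pderiv_pCons one_pCons)
    also have "P * pderiv (P ^ \<alpha>) = of_nat \<alpha> * pderiv P * P ^ \<alpha>" by (rule mult_pderiv_power)
    also have "Q * pderiv (Q ^ \<beta>) = of_nat \<beta> * pderiv Q * Q ^ \<beta>" by (rule mult_pderiv_power)
    finally show ?thesis
      unfolding A_def L_def \<alpha>_def[symmetric] \<beta>_def[symmetric] \<gamma>_def[symmetric]
      by (simp add: algebra_simps)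
  qed
  have degP: "degree P = 2" and degQ: "degree Q = 2" and degR: "degree R = 1" and degX: "degree X = 1"
    and degP': "degree (pderiv P) = 1" and degQ': "degree (pderiv Q) = 1"
    by (simp_all add: P_def Q_def R_def X_def pderiv_pCons)
  have degW: "degree W \<le> 4"
    unfolding W_def using degree_mult_le[of P Q] degP degQ by simp
  have degL: "degree (L i j) \<le> 3" for i j
  proof -
    have const: "degree (of_nat n * f) \<le> degree f" for n and f :: "int poly"
      using degree_mult_le[of "of_nat n" f] by simp
    have "degree (of_nat (i * m) * pderiv P * Q) \<le> 3"
      using const[of "i * m" "pderiv P * Q"] degree_mult_le[of "pderiv P" Q] degQ degP' by (simp add: mult.assoc)
    moreover have "degree (of_nat ((k - 1 - i) * m) * pderiv Q * P) \<le> 3"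
      using const[of "(k - 1 - i) * m" "pderiv Q * P"] degree_mult_le[of "pderiv Q" P] degP degQ'
      by (simp add: mult.assoc)
    moreover have "degree (of_nat (p * j) * (R * Q)) \<le> 3"
      using const[of "p * j" "R * Q"] degree_mult_le[of R Q] degQ degR by simp
    ultimately show ?thesis unfolding L_def by (intro degree_add_le)
  qed
  have "\<forall>i j t l. \<exists>G. degree G \<le> t + 3 * l \<and>
      W ^ l * (pderiv ^^ l) (Polynomial.monom 1 t * A i j) = G * A i j"
  proof (intro allI)
    fix i j t l
    show "\<exists>G. degree G \<le> t + 3 * l \<and> W ^ l * (pderiv ^^ l) (Polynomial.monom 1 t * A i j) = G * A i j"
      using weighted_higher_pderiv[OF dA degW degL, where g = "Polynomial.monom 1 t" and l = l and i1 = i and j1 = j]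
      by (simp add: degree_monom_eq)
  qed
  then obtain G where G: "\<And>i j t l. degree (G i j t l) \<le> t + 3 * l"
      "\<And>i j t l. W ^ l * (pderiv ^^ l) (Polynomial.monom 1 t * A i j) = G i j t l * A i j"
    by metis
  \<comment> \<open>\<open>I\<close> indexes the unknown coefficients. \<open>C\<close> indexes the
    conditions: for each order \<open>l < M\<close>, the coefficients in degrees below
    \<open>m + 3 * M + J\<close> of the polynomial that stands for the \<open>l\<close>-th
    derivative on \<open>S\<close>. By \<open>lt\<close> the unknowns outnumber the
    conditions.\<close>
  define I where "I = {..<k} \<times> {..<J} \<times> {..<m}"
  define C where "C = {..<M} \<times> {..<m + 3 * M + J}"
  define a where "a = (\<lambda>(i, j, t) (l, n). Polynomial.coeff (G i j t l * Polynomial.monom 1 j) n)"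
  have "card C < card I" using lt by (simp add: I_def C_def)
  then obtain r where r: "\<exists>x\<in>I. \<not> int p dvd r x" "\<And>x. x \<in> C \<Longrightarrow> int p dvd (\<Sum>y\<in>I. r y * a y x)"
    using nontrivial_kernel_mod[OF pgt, of I C a] by (auto simp: I_def C_def)
  define f where "f = (\<lambda>(i, j, t). Polynomial.monom 1 t * A i j)"
  define h where "h = (\<Sum>x\<in>I. Polynomial.smult (r x) (f x))"
  have vanish: "[:int p:] dvd (\<Sum>(i, j, t)\<in>I. Polynomial.smult (r (i, j, t)) (G i j t l * Polynomial.monom 1 j))" (is "_ dvd ?g")
    if l: "l < M" for l
  proof -
    have "int p dvd Polynomial.coeff ?g n" for n
    proof (cases "n < m + 3 * M + J")
      case True
      then have "int p dvd (\<Sum>y\<in>I. r y * a y (l, n))" using r(2)[of "(l, n)"] l by (simp add: C_def)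
      also have "(\<Sum>y\<in>I. r y * a y (l, n)) = Polynomial.coeff ?g n"
        by (simp add: coeff_sum a_def case_prod_beta)
      finally show ?thesis .
    next
      \<comment> \<open>Nothing needs to be imposed in higher degrees: each summand has degree at
        most \<open>t + 3 * l + j\<close>.\<close>
      case False
      have "Polynomial.coeff ?g n = (\<Sum>(i, j, t)\<in>I. r (i, j, t) * Polynomial.coeff (G i j t l * Polynomial.monom 1 j) n)"
        by (simp add: coeff_sum case_prod_beta)
      also have "\<dots> = 0"
      proof (rule sum.neutral, clarify)
        fix i j t assume "(i, j, t) \<in> I"
        then have "degree (G i j t l * Polynomial.monom 1 j) < n"
          using degree_mult_le[of "G i j t l" "Polynomial.monom 1 j"] G(1)[of i j t l] False l
          by (simp add: I_def degree_monom_eq)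
        then show "r (i, j, t) * Polynomial.coeff (G i j t l * Polynomial.monom 1 j) n = 0" by (simp add: coeff_eq_0)
      qed
      finally show ?thesis by simp
    qed
    then show ?thesis by (simp add: const_poly_dvd_iff)
  qed
  have root: "int p dvd poly ((pderiv ^^ l) h) x" if x: "x \<in> S" and l: "l < M" for x l
  proof -
    define s where "s = poly P x ^ m"
    have Px: "poly P x = x * (x + b)" and Qx: "poly Q x = (x + c) * (x + e)"
      by (simp_all add: P_def Q_def algebra_simps)
    have xS: "\<not> int p dvd x" "\<not> int p dvd x + b" "\<not> int p dvd x + c" "\<not> int p dvd x + e"
        "[poly P x ^ m = poly Q x ^ m] (mod int p)"
      using x by (auto simp: S_def quadratic_ratio_set_def Px Qx)
    \<comment> \<open>On \<open>S\<close> both \<open>P ^ m\<close> and \<open>Q ^ m\<close> have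
      the value \<open>s\<close>, so the value of \<open>A i j\<close> no longer depends on
      \<open>i\<close> and \<open>s ^ (k - 1)\<close> factors out of the whole sum.\<close>
    have Ax: "[poly (A i j) x = s ^ (k - 1) * x ^ j] (mod int p)" if "i < k" for i j
    proof -
      have "poly (A i j) x = (poly P x ^ m) ^ i * (poly Q x ^ m) ^ (k - 1 - i) * (x ^ p) ^ j"
      proof -
        have "y ^ (n * m) = (y ^ m) ^ n" for y :: int and n by (subst mult.commute) (rule power_mult)
        then show ?thesis by (simp add: A_def X_def power_mult[of x p j])
      qed
      also have "[\<dots> = s ^ i * s ^ (k - 1 - i) * x ^ j] (mod int p)"
        unfolding s_def
        by (intro cong_mult[OF cong_mult[OF cong_refl cong_pow[OF cong_sym[OF xS(5)]]]
              cong_pow[OF fermat_int[OF p]]])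
      also have "s ^ i * s ^ (k - 1 - i) = s ^ (k - 1)" using that by (simp flip: power_add)
      finally show ?thesis .
    qed
    have "poly (W ^ l * (pderiv ^^ l) h) x =
        (\<Sum>(i, j, t)\<in>I. r (i, j, t) * (poly (G i j t l) x * poly (A i j) x))"
    proof -
      have "W ^ l * (pderiv ^^ l) h = (\<Sum>(i, j, t)\<in>I. Polynomial.smult (r (i, j, t)) (G i j t l * A i j))"
        unfolding h_def higher_pderiv_sum higher_pderiv_smult sum_distrib_left
        by (rule sum.cong) (auto simp: f_def G(2))
      then show ?thesis by (simp add: poly_sum case_prod_beta)
    qed
    also have "[\<dots> = (\<Sum>(i, j, t)\<in>I. r (i, j, t) * (poly (G i j t l) x * (s ^ (k - 1) * x ^ j)))] (mod int p)"
      by (rule cong_sum) (auto simp: I_def simp del: One_nat_def intro!: cong_mult Ax)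
    also have "(\<Sum>(i, j, t)\<in>I. r (i, j, t) * (poly (G i j t l) x * (s ^ (k - 1) * x ^ j))) =
       s ^ (k - 1) * poly (\<Sum>(i, j, t)\<in>I. Polynomial.smult (r (i, j, t)) (G i j t l * Polynomial.monom 1 j)) x"
      by (simp add: poly_sum case_prod_beta sum_distrib_left poly_monom algebra_simps)
    also have "[\<dots> = 0] (mod int p)"
      using const_dvd_poly[OF vanish[OF l]] by (simp add: cong_0_iff)
    finally have "int p dvd poly W x ^ l * poly ((pderiv ^^ l) h) x" by (simp add: cong_0_iff)
    moreover have "\<not> int p dvd poly W x ^ l"
      using xS(1-4) pint prime_dvd_power[OF pint, of "poly W x" l]
      by (auto simp: W_def Px Qx prime_dvd_mult_iff)
    ultimately show ?thesis using pint prime_dvd_mult_iff by blast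
  qed
  have nonzero: "\<not> [:int p:] dvd h"
  proof -
    define N where "N = (\<lambda>(i, j, t). t + i * m + p * j)"
    define B where "B = (\<lambda>i. R ^ (i * m) * Q ^ ((k - 1 - i) * m))"
    have inj: "inj_on N I"
      unfolding N_def I_def by (rule mixed_radix_inj) (use km pgt in simp)
    have f: "f (i, j, t) = Polynomial.monom 1 (N (i, j, t)) * B i" for i j t
    proof -
      have "X ^ n = Polynomial.monom 1 n" for n by (simp add: X_def monom_altdef)
      then have "Polynomial.monom 1 t * (X ^ (i * m) * X ^ (p * j)) = Polynomial.monom 1 (N (i, j, t))"
        by (simp add: mult_monom N_def add.assoc)
      moreover have "f (i, j, t) = Polynomial.monom 1 t * (X ^ (i * m) * X ^ (p * j)) * B i"
        by (simp add: f_def A_def B_def PXR power_mult_distrib mult_ac)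
      ultimately show ?thesis by simp
    qed
    \<comment> \<open>Among the terms with coefficient nonzero modulo \<open>p\<close>, the one of
      least order at 0 cannot be cancelled, as the orders are distinct.\<close>
    obtain x where x: "x \<in> I" "\<not> int p dvd r x" and min: "\<And>y. y \<in> I \<Longrightarrow> \<not> int p dvd r y \<Longrightarrow> N x \<le> N y"
      using ex_has_least_nat[of "\<lambda>x. x \<in> I \<and> \<not> int p dvd r x" _ N] r(1) by (metis (no_types, lifting))
    obtain i j t where ijt: "x = (i, j, t)" by (cases x)
    have "int p dvd Polynomial.coeff (Polynomial.smult (r y) (f y)) (N x)" if y: "y \<in> I - {x}" for y
    proof (cases "int p dvd r y")
      case False
      then have "N x \<le> N y" using min[of y] y by simp
      moreover have "N x \<noteq> N y" using inj_onD[OF inj, of x y] x y by auto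
      ultimately have "N x < N y" by simp
      moreover obtain i' j' t' where "y = (i', j', t')" by (cases y)
      ultimately show ?thesis by (simp add: f coeff_monom_mult)
    qed simp
    then have "int p dvd (\<Sum>y\<in>I - {x}. Polynomial.coeff (Polynomial.smult (r y) (f y)) (N x))" by (rule dvd_sum)
    moreover have "Polynomial.coeff h (N x) = Polynomial.coeff (Polynomial.smult (r x) (f x)) (N x) + (\<Sum>y\<in>I - {x}. Polynomial.coeff (Polynomial.smult (r y) (f y)) (N x))"
      unfolding h_def coeff_sum using x by (intro sum.remove) (auto simp: I_def)
    moreover have "\<not> int p dvd Polynomial.coeff (Polynomial.smult (r x) (f x)) (N x)"
    proof -
      \<comment> \<open>The leading factor is the value of \<open>B i\<close> at 0, a product of
        powers of \<open>b\<close> and \<open>c * e\<close>, hence a unit modulo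
        \<open>p\<close>.\<close>
      have "Polynomial.coeff (Polynomial.smult (r x) (f x)) (N x) = r x * (b ^ (i * m) * (c * e) ^ ((k - 1 - i) * m))"
        by (simp add: ijt f coeff_monom_mult B_def coeff_0_power coeff_mult_0 R_def Q_def)
      then show ?thesis
        using x(2) b c e pint prime_dvd_power[OF pint, of b] prime_dvd_power[OF pint, of "c * e"]
        by (auto simp: prime_dvd_mult_iff)
    qed
    ultimately have "\<not> int p dvd Polynomial.coeff h (N x)" by (simp add: dvd_add_left_iff)
    then show ?thesis by (auto simp: const_poly_dvd_iff)
  qed
  have "finite S"
    unfolding S_def quadratic_ratio_set_def by (rule finite_subset[of _ "{0..<int p}"]) auto
  then have "(\<Sum>x\<in>S. M) \<le> degree h"
  proof (rule sum_multiplicities_mod_le_degree[OF p])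
    show "\<not> int p dvd x - y" if "x \<in> S" "y \<in> S" "x \<noteq> y" for x y
    proof
      assume "int p dvd x - y"
      then have "x mod int p = y mod int p" by (simp add: mod_eq_dvd_iff)
      then show False using that by (simp add: S_def quadratic_ratio_set_def)
    qed
  qed (use M root nonzero in auto)
  moreover have "degree h \<le> m + 2 * (k - 1) * m + p * J - p"
  proof -
    have "degree (Polynomial.smult (r x) (f x)) \<le> m + 2 * (k - 1) * m + p * J - p" if xI: "x \<in> I" for x
    proof -
      obtain i j t where x: "x = (i, j, t)" by (cases x)
      have lts: "i < k" "j < J" "t < m" using xI by (auto simp: x I_def)
      have dpow: "degree (g ^ n) \<le> degree g * n" for g :: "int poly" and n by (rule degree_power_le)
      have "degree (Polynomial.smult (r x) (f x)) \<le> degree (f x)" by (rule degree_smult_le)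
      also have "\<dots> \<le> t + (2 * (i * m) + 2 * ((k - 1 - i) * m) + p * j)"
        unfolding f_def x A_def prod.case
        using degree_mult_le[of "Polynomial.monom 1 t" "P ^ (i * m) * Q ^ ((k - 1 - i) * m) * X ^ (p * j)"]
          degree_mult_le[of "P ^ (i * m) * Q ^ ((k - 1 - i) * m)" "X ^ (p * j)"]
          degree_mult_le[of "P ^ (i * m)" "Q ^ ((k - 1 - i) * m)"]
          dpow[of P "i * m"] dpow[of Q "(k - 1 - i) * m"] dpow[of X "p * j"]
        by (simp add: degP degQ degX degree_monom_eq)
      also have "2 * (i * m) + 2 * ((k - 1 - i) * m) = 2 * (k - 1) * m"
      proof -
        have "2 * (i * m) + 2 * ((k - 1 - i) * m) = 2 * (i + (k - 1 - i)) * m" by (simp only: algebra_simps)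
        then show ?thesis using lts by simp
      qed
      also have "t + (2 * (k - 1) * m + p * j) \<le> m + 2 * (k - 1) * m + p * J - p"
      proof -
        have "p * j + p \<le> p * J" using lts mult_le_mono2[of "Suc j" J p] by simp
        then show ?thesis using lts by simp
      qed
      finally show ?thesis .
    qed
    then show ?thesis unfolding h_def by (intro degree_sum_le) (auto simp: I_def)
  qed
  ultimately show ?thesis by (simp add: S_def)
qed

text \<open>Multiplicity \<open>M\<close> near \<open>sqrt p\<close> is prescribed, with
  \<open>J\<close> near \<open>M / k + 6\<close>. Dividing the degree bound by \<open>M\<close>
  leaves the main term \<open>p / k\<close> and an error of order \<open>sqrt p\<close> that does
  not depend on \<open>k\<close>.\<close>

lemma card_quadratic_ratio_set_le:
  fixes p k m :: nat
  assumes p: "prime p" "p \<ge> 100" and km: "k * m = p - 1" and k: "k \<ge> 2"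
    and b: "\<not> int p dvd b" and c: "\<not> int p dvd c" and e: "\<not> int p dvd e"
  shows "real (card (quadratic_ratio_set p m b c e)) \<le> real m + 9 * sqrt (real p)"
proof -
  define M where "M = nat \<lfloor>sqrt (real p)\<rfloor>"
  define J where "J = (M * m) div (p - 1) + 6"
  define n where "n = real p - 1"
  define N where "N = card (quadratic_ratio_set p m b c e)"
  have n: "n \<ge> 99" "real (p - 1) = n" using p(2) by (simp_all add: n_def of_nat_diff)
  have sq: "sqrt (real p) * sqrt (real p) = real p" by simp
  have s10: "sqrt (real p) \<ge> 10" using p(2) by (intro real_le_rsqrt) simp
  have Mle: "real M \<le> sqrt (real p)" and Mge: "real M \<ge> sqrt (real p) - 1"
    unfolding M_def using s10 by linarith+
  have M0: "real M \<ge> 9" using Mge s10 by simp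
  have M2: "real M * real M \<le> real p" using mult_mono[OF Mle Mle] sq s10 by simp
  have Mp: "10 * real M \<le> real p"
    using mult_right_mono[OF s10, of "sqrt (real p)"] Mle sq by simp
  have m2: "2 * real m \<le> n"
    using mult_le_mono1[OF k, of m] km n(2) by linarith
  have Mm: "real M * real m \<le> n * real M / 2"
    using mult_left_mono[OF m2, of "real M"] by (simp add: mult_ac)
  define D where "D = M * m div (p - 1)"
  have J: "n * real J = n * real D + 6 * n"
    unfolding J_def D_def by (simp add: algebra_simps)
  have "(p - 1) * D + (M * m) mod (p - 1) = M * m" by (simp add: D_def)
  then have div: "n * real D + real ((M * m) mod (p - 1)) = real M * real m"
    using n(2) by (metis of_nat_add of_nat_mult)
  have "(M * m) mod (p - 1) < p - 1" using p(2) by simp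
  then have "real ((M * m) mod (p - 1)) < n" using n(2) by linarith
  then have Jge: "n * real J \<ge> real M * real m + 5 * n"
    using div J by linarith
  have Jle: "n * real J \<le> real M * real m + 6 * n"
    using div J by linarith
  have "n * real J \<le> n * (real M / 2 + 6)" using Jle Mm by (simp add: algebra_simps)
  then have "real J \<le> real M / 2 + 6" using n(1) by simp
  from mult_left_mono[OF this, of "real M"]
  have MJ: "real M * real J \<le> real p / 2 + 6 * real M" using M2 by (simp add: algebra_simps)
  \<comment> \<open>The surplus \<open>5 * n\<close> in \<open>Jge\<close> pays for
    \<open>3 * M ^ 2 + M * J\<close>, which is at most \<open>3 * p + p / 2 + 6 * M\<close> and so
    at most \<open>4.1 * p\<close>.\<close>
  have "real M * (real m + 3 * real M + real J) < n * real J"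
    using Jge MJ M2 Mp n p(2) by (simp add: algebra_simps n_def)
  also have "n * real J = real (k * (J * m))" using km n(2) by (metis mult.assoc mult.commute of_nat_mult)
  finally have "M * (m + 3 * M + J) < k * (J * m)"
    by (metis (no_types, lifting) of_nat_add of_nat_less_iff of_nat_mult of_nat_numeral)
  moreover have "M \<le> p" using Mp by simp
  ultimately have "N * M \<le> m + 2 * (k - 1) * m + p * J - p"
    unfolding N_def by (intro card_quadratic_ratio_set_mult_le[OF p(1) km b c e])
  also have "\<dots> \<le> p * (J + 1)"
  proof -
    have "m + 2 * (k - 1) * m \<le> 2 * (k * m)" using k by (cases k) (auto simp: algebra_simps)
    then show ?thesis using km p(2) by (simp add: algebra_simps)
  qed
  finally have "real N * real M \<le> real p * (real J + 1)"
    by (metis of_nat_1 of_nat_add of_nat_le_iff of_nat_mult)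
  also have "\<dots> \<le> real p * (real M * real m / n + 7)"
    using Jle n by (intro mult_left_mono) (auto simp: field_simps)
  also have "\<dots> = real M * (real p * (real m / n)) + 7 * real p" by (simp add: algebra_simps)
  also have "real p * (real m / n) = real m + real m / n" using n by (simp add: n_def field_simps)
  also have "real M * (real m + real m / n) \<le> real M * (real m + 1)"
    using m2 n by (intro mult_left_mono add_left_mono) (auto simp: field_simps)
  also have "7 * real p \<le> real M * (9 * sqrt (real p) - 1)"
  proof -
    \<comment> \<open>Since \<open>sqrt p \<ge> 10\<close>, subtracting 1 costs at most a tenth of
      \<open>sqrt p\<close> in either factor.\<close>
    have "(9/10 * sqrt (real p)) * (89/10 * sqrt (real p)) \<le> real M * (9 * sqrt (real p) - 1)"
      using Mge s10 by (intro mult_mono) auto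
    moreover have "(9/10 * sqrt (real p)) * (89/10 * sqrt (real p)) = 801/100 * (sqrt (real p) * sqrt (real p))"
      by simp
    ultimately show ?thesis unfolding sq by linarith
  qed
  finally have "real M * real N \<le> real M * (real m + 9 * sqrt (real p))" by (simp add: algebra_simps)
  then show ?thesis unfolding N_def[symmetric] using M0 by simp
qed

section \<open>Multiplicative characters and their fourth moment\<close>

lemma sum_cis_int:
  assumes k: "k > 0"
  shows "(\<Sum>j<k. cis (2 * pi * real j * real_of_int n / real k)) = (if int k dvd n then of_nat k else 0)"
proof -
  define z where "z = cis (2 * pi * real_of_int n / real k)"
  have pow: "cis (2 * pi * real j * real_of_int n / real k) = z ^ j" for j
    by (simp add: z_def Complex.DeMoivre mult_ac)
  show ?thesis
  proof (cases "int k dvd n")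
    case True
    then obtain q where "n = int k * q" by auto
    then have "2 * pi * real_of_int n / real k = 2 * pi * real_of_int q" using k by simp
    then have "z = 1" by (simp only: z_def) (simp add: cis_multiple_2pi)
    then show ?thesis using True by (simp add: pow)
  next
    case False
    have "z \<noteq> 1"
    proof
      assume "z = 1"
      then have "cos (2 * pi * real_of_int n / real k) = 1" by (simp add: z_def complex_eq_iff)
      then obtain q :: int where "2 * pi * real_of_int n / real k = real_of_int q * 2 * pi"
        using cos_one_2pi_int by blast
      then have "real_of_int n = real_of_int (q * int k)" using k by (simp add: field_simps)
      then have "n = q * int k" by (simp only: of_int_eq_iff)
      then show False using False by simp
    qed
    moreover have "z ^ k = 1"
    proof -
      have "z ^ k = cis (2 * pi * real_of_int n)" using k by (simp add: z_def Complex.DeMoivre)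
      then show ?thesis by (simp add: cis_multiple_2pi)
    qed
    ultimately show ?thesis using False by (simp add: pow geometric_sum)
  qed
qed

section \<open>Discrete logarithms and the characters built from them\<close>

locale discrete_log =
  fixes p g :: nat
  assumes prime: "prime p" and primroot: "residue_primroot p g"
begin

text \<open>A discrete logarithm to base \<open>g\<close>. The chosen exponent is arbitrary, so only
  its class modulo \<open>p - 1\<close> carries meaning; at multiples of \<open>p\<close> the value
  is an unspecified default.\<close>

definition ind :: "int \<Rightarrow> nat" where
  "ind x = (SOME n. [int g ^ n = x] (mod int p))"

lemma p_gt_1: "p > 1"
  using prime by (rule prime_gt_1_nat)

lemma prime_int: "prime (int p)"
  using prime by simp

lemma ind: "[int g ^ ind x = x] (mod int p)" if "\<not> int p dvd x"
proof -
  define y where "y = nat (x mod int p)"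
  have y: "int y = x mod int p" using p_gt_1 by (simp add: y_def)
  have "\<not> p dvd y" using that y by (metis dvd_mod_iff dvd_refl int_dvd_int_iff)
  moreover have "y < p" using p_gt_1 by (simp add: y_def nat_less_iff)
  ultimately have "y \<in> totatives p"
    using prime p_gt_1 by (auto simp: totatives_prime intro!: Nat.gr0I)
  then obtain i where "g ^ i mod p = y"
    using bij_betw_imp_surj_on[OF residue_primroot_is_generator[OF p_gt_1 primroot]]
    by (metis (no_types, lifting) imageE)
  then have "[int g ^ i = x] (mod int p)"
    using y by (metis cong_def mod_mod_trivial of_nat_power zmod_int)
  then show ?thesis unfolding ind_def by (rule someI)
qed

lemma ind_cong: "[x = y] (mod int p) \<Longrightarrow> ind x = ind y"
  unfolding ind_def by (metis cong_sym cong_trans)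

lemma power_cong_iff: "[int g ^ a = int g ^ b] (mod int p) \<longleftrightarrow> [a = b] (mod (p - 1))"
proof -
  have "[int g ^ a = int g ^ b] (mod int p) \<longleftrightarrow> [g ^ a = g ^ b] (mod p)"
    by (metis cong_int_iff of_nat_power)
  also have "\<dots> \<longleftrightarrow> [a = b] (mod (p - 1))"
    using primroot order_divides_expdiff[of p g a b] prime
    by (simp add: residue_primroot_def totient_prime)
  finally show ?thesis .
qed

lemma ind_mult:
  assumes "\<not> int p dvd x" "\<not> int p dvd y"
  shows "[ind (x * y) = ind x + ind y] (mod (p - 1))"
proof -
  have "\<not> int p dvd x * y" using assms prime_int by (simp add: prime_dvd_mult_iff)
  then have "[int g ^ ind (x * y) = x * y] (mod int p)" by (rule ind)
  moreover have "[int g ^ ind x * int g ^ ind y = x * y] (mod int p)"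
    using assms by (intro cong_mult ind)
  ultimately have "[int g ^ ind (x * y) = int g ^ (ind x + ind y)] (mod int p)"
    by (metis cong_sym cong_trans power_add)
  then show ?thesis by (simp add: power_cong_iff)
qed

text \<open>For \<open>k\<close> dividing \<open>p - 1\<close> and \<open>j < k\<close> these are
  the multiplicative characters of order dividing \<open>k\<close>, extended by 0 to the multiples
  of \<open>p\<close>; \<open>j = 0\<close> is the principal one.\<close>

definition char :: "nat \<Rightarrow> nat \<Rightarrow> int \<Rightarrow> complex" where
  "char k j x = (if int p dvd x then 0 else cis (2 * pi * real j * real (ind x) / real k))"

lemma char_cong: "[x = y] (mod int p) \<Longrightarrow> char k j x = char k j y"
  by (simp add: char_def ind_cong cong_dvd_iff)

lemma cis_cong:
  assumes "[a = b] (mod k)" "k > 0"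
  shows "cis (2 * pi * real j * real a / real k) = cis (2 * pi * real j * real b / real k)"
proof -
  have "[int a = int b] (mod int k)" using assms by (simp add: cong_int_iff)
  then obtain q where "int b = int a + int k * q" by (metis cong_iff_lin)
  then have "real b = real a + real k * real_of_int q"
    by (metis of_int_add of_int_mult of_int_of_nat_eq)
  then have "2 * pi * real j * real b / real k = 2 * pi * real j * real a / real k + 2 * pi * real_of_int (int j * q)"
    using assms(2) by (simp add: field_simps)
  then show ?thesis by (simp only: cis_mult[symmetric]) (simp del: of_int_mult add: cis_multiple_2pi)
qed

lemma char_mult:
  assumes "k dvd p - 1"
  shows "char k j (x * y) = char k j x * char k j y"
proof (cases "int p dvd x \<or> int p dvd y")
  case True
  then show ?thesis by (auto simp: char_def)
next
  case False
  then have nd: "\<not> int p dvd x" "\<not> int p dvd y" "\<not> int p dvd x * y"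
    using prime_int by (auto simp: prime_dvd_mult_iff)
  have k: "k > 0" using assms p_gt_1 by (cases k) auto
  have "[ind (x * y) = ind x + ind y] (mod k)"
    using ind_mult[OF nd(1,2)] assms by (rule cong_dvd_modulus_nat)
  then show ?thesis using nd cis_cong[OF _ k] by (simp add: char_def cis_mult distrib_left add_divide_distrib)
qed

lemma norm_char_le: "cmod (char k j x) \<le> 1"
  by (simp add: char_def)

lemma sum_char:
  assumes "k > 0"
  shows "(\<Sum>j<k. char k j x) = (if \<not> int p dvd x \<and> k dvd ind x then of_nat k else 0)"
proof (cases "int p dvd x")
  case False
  then show ?thesis using sum_cis_int[OF assms, of "int (ind x)"] by (simp add: char_def)
qed (simp add: char_def)

lemma sum_char_quadruple:
  assumes "k > 0"
  shows "(\<Sum>j<k. char k j a * char k j b * cnj (char k j c) * cnj (char k j d)) =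
    (if \<not> int p dvd a \<and> \<not> int p dvd b \<and> \<not> int p dvd c \<and> \<not> int p dvd d \<and>
       int k dvd int (ind a) + int (ind b) - int (ind c) - int (ind d) then of_nat k else 0)"
proof (cases "\<not> int p dvd a \<and> \<not> int p dvd b \<and> \<not> int p dvd c \<and> \<not> int p dvd d")
  case True
  then have "(\<Sum>j<k. char k j a * char k j b * cnj (char k j c) * cnj (char k j d)) =
    (\<Sum>j<k. cis (2 * pi * real j * real_of_int (int (ind a) + int (ind b) - int (ind c) - int (ind d)) / real k))"
    by (intro sum.cong refl)
      (simp add: char_def cis_cnj cis_mult right_diff_distrib distrib_left add_divide_distrib diff_divide_distrib)
  then show ?thesis using True by (simp only: sum_cis_int[OF assms]) simp
qed (auto simp: char_def)

text \<open>For \<open>k\<close> dividing \<open>p - 1\<close>, these are the points where the ratio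
  of \<open>(x + a) * (x + b)\<close> to \<open>(x + c) * (x + d)\<close> is a nonzero
  \<open>k\<close>-th power, expressed by indices as orthogonality produces it.\<close>

definition solutions :: "nat \<Rightarrow> int \<Rightarrow> int \<Rightarrow> int \<Rightarrow> int \<Rightarrow> int set" where
  "solutions k a b c d = {x \<in> {0..<int p}. \<not> int p dvd x + a \<and> \<not> int p dvd x + b \<and>
     \<not> int p dvd x + c \<and> \<not> int p dvd x + d \<and>
     int k dvd int (ind (x + a)) + int (ind (x + b)) - int (ind (x + c)) - int (ind (x + d))}"

lemma finite_solutions [simp]: "finite (solutions k a b c d)"
  unfolding solutions_def by (rule finite_subset[of _ "{0..<int p}"]) auto

lemma card_solutions_le_p: "card (solutions k a b c d) \<le> p"
proof -
  have "card (solutions k a b c d) \<le> card {0..<int p}"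
    unfolding solutions_def by (rule card_mono) auto
  then show ?thesis by simp
qed

text \<open>Translation by \<open>a\<close> moves one zero to the origin, where Stepanov's bound
  applies. It needs the shift \<open>a\<close> to differ from the other three modulo
  \<open>p\<close>, but these may coincide with one another.\<close>

lemma card_solutions_le:
  assumes p: "p \<ge> 100" and km: "k * m = p - 1" and k: "k \<ge> 2"
    and b: "\<not> int p dvd b - a" and c: "\<not> int p dvd c - a" and d: "\<not> int p dvd d - a"
  shows "real (card (solutions k a b c d)) \<le> real m + 9 * sqrt (real p)"
proof -
  define f where "f = (\<lambda>x. (x + a) mod int p)"
  have inj: "inj_on f (solutions k a b c d)"
  proof (rule inj_onI)
    fix x y assume xy: "x \<in> solutions k a b c d" "y \<in> solutions k a b c d" "f x = f y"
    then have "[x = y] (mod int p)" unfolding f_def by (metis cong_add_rcancel cong_def)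
    then show "x = y" using xy by (auto simp: cong_def solutions_def)
  qed
  have "f x \<in> quadratic_ratio_set p m (b - a) (c - a) (d - a)" if x: "x \<in> solutions k a b c d" for x
  proof -
    have nd: "\<not> int p dvd x + a" "\<not> int p dvd x + b" "\<not> int p dvd x + c" "\<not> int p dvd x + d"
      and kd: "int k dvd (int (ind (x + a)) + int (ind (x + b))) - (int (ind (x + c)) + int (ind (x + d)))"
      using x by (auto simp: solutions_def algebra_simps)
    have fx: "[f x + t = x + (a + t)] (mod int p)" for t
      unfolding f_def cong_def by (simp add: mod_add_left_eq add.assoc)
    have fx': "[f x + (t - a) = x + t] (mod int p)" for t using fx[of "t - a"] by simp
    have fx0: "[f x = x + a] (mod int p)" using fx[of 0] by simp
    \<comment> \<open>Multiplying by \<open>m\<close> turns divisibility by \<open>k\<close> into a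
      congruence of exponents modulo \<open>p - 1\<close>, that is, into equality of
      \<open>m\<close>-th powers modulo \<open>p\<close>.\<close>
    have "int m * int k dvd int m * ((int (ind (x + a)) + int (ind (x + b))) - (int (ind (x + c)) + int (ind (x + d))))"
      using kd by (rule mult_dvd_mono[OF dvd_refl])
    then have "[int (m * (ind (x + a) + ind (x + b))) = int (m * (ind (x + c) + ind (x + d)))] (mod int (p - 1))"
      unfolding cong_iff_dvd_diff km[symmetric] by (simp add: algebra_simps)
    then have "[m * (ind (x + a) + ind (x + b)) = m * (ind (x + c) + ind (x + d))] (mod (p - 1))"
      by (simp only: cong_int_iff)
    then have "[int g ^ (m * (ind (x + a) + ind (x + b))) = int g ^ (m * (ind (x + c) + ind (x + d)))] (mod int p)"
      by (simp only: power_cong_iff)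
    moreover have "[int g ^ (m * (ind s + ind t)) = (s * t) ^ m] (mod int p)"
      if "\<not> int p dvd s" "\<not> int p dvd t" for s t
    proof -
      have "int g ^ (m * (ind s + ind t)) = (int g ^ ind s * int g ^ ind t) ^ m"
        by (simp only: power_add[symmetric] power_mult[symmetric] mult.commute)
      also have "[\<dots> = (s * t) ^ m] (mod int p)"
        by (intro cong_pow cong_mult ind that)
      finally show ?thesis .
    qed
    ultimately have "[((x + a) * (x + b)) ^ m = ((x + c) * (x + d)) ^ m] (mod int p)"
      using nd by (meson cong_sym cong_trans)
    moreover have "[(f x * (f x + (b - a))) ^ m = ((x + a) * (x + b)) ^ m] (mod int p)"
      by (intro cong_pow cong_mult fx0 fx')
    moreover have "[((f x + (c - a)) * (f x + (d - a))) ^ m = ((x + c) * (x + d)) ^ m] (mod int p)"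
      by (intro cong_pow cong_mult fx0 fx')
    ultimately have "[(f x * (f x + (b - a))) ^ m = ((f x + (c - a)) * (f x + (d - a))) ^ m] (mod int p)"
      by (meson cong_sym cong_trans)
    moreover have "\<not> int p dvd f x" "\<not> int p dvd f x + (b - a)" "\<not> int p dvd f x + (c - a)" "\<not> int p dvd f x + (d - a)"
      using nd cong_dvd_iff[OF fx0] cong_dvd_iff[OF fx'] by auto
    moreover have "f x \<in> {0..<int p}" using p_gt_1 by (simp add: f_def)
    ultimately show ?thesis unfolding quadratic_ratio_set_def by blast
  qed
  then have "f ` solutions k a b c d \<subseteq> quadratic_ratio_set p m (b - a) (c - a) (d - a)" by blast
  moreover have "finite (quadratic_ratio_set p m (b - a) (c - a) (d - a))"
    unfolding quadratic_ratio_set_def by (rule finite_subset[of _ "{0..<int p}"]) auto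
  ultimately have "card (solutions k a b c d) \<le> card (quadratic_ratio_set p m (b - a) (c - a) (d - a))"
    using card_inj_on_le[OF inj] by blast
  then show ?thesis
    using card_quadratic_ratio_set_le[OF prime p km k b c d] by linarith
qed

lemma solutions_commute: "solutions k a b c d = solutions k b a c d"
  by (auto simp: solutions_def algebra_simps)

lemma solutions_swap: "solutions k a b c d = solutions k c d a b"
proof -
  have "int k dvd s + t - u - v \<longleftrightarrow> int k dvd u + v - s - t" for s t u v :: int
    by (subst dvd_minus_iff[symmetric]) (simp add: algebra_simps)
  then show ?thesis by (auto simp: solutions_def)
qed

text \<open>The fourth power of the modulus is expanded over quadruples from \<open>V\<close>;
  orthogonality in \<open>j\<close> then detects the \<open>k\<close>-th power condition.\<close>

lemma fourth_moment_eq: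
  assumes k: "k > 0" and V: "finite V"
  shows "(\<Sum>j<k. \<Sum>x\<in>{0..<int p}. cmod (\<Sum>v\<in>V. char k j (x + v)) ^ 4) =
    real k * (\<Sum>a\<in>V. \<Sum>b\<in>V. \<Sum>c\<in>V. \<Sum>d\<in>V. real (card (solutions k a b c d)))"
proof -
  have quad: "complex_of_real (cmod (\<Sum>v\<in>V. f v) ^ 4) =
      (\<Sum>a\<in>V. \<Sum>b\<in>V. \<Sum>c\<in>V. \<Sum>d\<in>V. f a * f b * cnj (f c) * cnj (f d))" for f :: "int \<Rightarrow> complex"
  proof -
    define z where "z = (\<Sum>v\<in>V. f v)"
    have "complex_of_real (cmod z ^ 4) = (complex_of_real ((cmod z)\<^sup>2)) * (complex_of_real ((cmod z)\<^sup>2))"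
      by (simp add: power_def numeral_eq_Suc)
    also have "\<dots> = (z * z) * (cnj z * cnj z)" by (simp only: complex_norm_square mult_ac)
    also have "\<dots> = (\<Sum>a\<in>V. \<Sum>b\<in>V. f a * f b) * (\<Sum>c\<in>V. \<Sum>d\<in>V. cnj (f c) * cnj (f d))"
      by (simp only: z_def cnj_sum sum_product)
    also have "\<dots> = (\<Sum>a\<in>V. \<Sum>b\<in>V. \<Sum>c\<in>V. \<Sum>d\<in>V. f a * f b * cnj (f c) * cnj (f d))"
      unfolding sum_distrib_right by (simp only: sum_distrib_left mult.assoc)
    finally show ?thesis by (simp add: z_def)
  qed
  have "complex_of_real (\<Sum>j<k. \<Sum>x\<in>{0..<int p}. cmod (\<Sum>v\<in>V. char k j (x + v)) ^ 4) =
    (\<Sum>j<k. \<Sum>x\<in>{0..<int p}. \<Sum>a\<in>V. \<Sum>b\<in>V. \<Sum>c\<in>V. \<Sum>d\<in>V.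
       char k j (x + a) * char k j (x + b) * cnj (char k j (x + c)) * cnj (char k j (x + d)))"
    by (simp add: quad del: of_real_power)
  also have "\<dots> = (\<Sum>a\<in>V. \<Sum>b\<in>V. \<Sum>c\<in>V. \<Sum>d\<in>V. \<Sum>x\<in>{0..<int p}. \<Sum>j<k.
       char k j (x + a) * char k j (x + b) * cnj (char k j (x + c)) * cnj (char k j (x + d)))"
    by (simp only: sum.swap[where A = "{..<k}" and B = V] sum.swap[where A = "{0..<int p}" and B = V]
        sum.swap[where A = "{..<k}" and B = "{0..<int p}"])
  also have "\<dots> = (\<Sum>a\<in>V. \<Sum>b\<in>V. \<Sum>c\<in>V. \<Sum>d\<in>V. of_nat k * of_nat (card (solutions k a b c d)))"
  proof -
    have "(\<Sum>x\<in>{0..<int p}. \<Sum>j<k. char k j (x + a) * char k j (x + b) * cnj (char k j (x + c)) * cnj (char k j (x + d)))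
       = of_nat k * of_nat (card (solutions k a b c d))" for a b c d
      unfolding sum_char_quadruple[OF k] solutions_def
      by (subst sum.inter_filter[symmetric]) auto
    then show ?thesis by simp
  qed
  also have "\<dots> = complex_of_real (real k * (\<Sum>a\<in>V. \<Sum>b\<in>V. \<Sum>c\<in>V. \<Sum>d\<in>V. real (card (solutions k a b c d))))"
    by (simp add: sum_distrib_left)
  finally show ?thesis by (simp only: of_real_eq_iff)
qed

end

text \<open>When \<open>p\<close> divides no element of \<open>U\<close>, this is the second moment
  of the number of representations of a residue as \<open>y / u\<close>, with the quotients
  cross-multiplied.\<close>

definition mult_energy :: "nat \<Rightarrow> int set \<Rightarrow> int set \<Rightarrow> nat" where
  "mult_energy p Y U = card {((y, u), (y', u')).
     (y, u) \<in> Y \<times> U \<and> (y', u') \<in> Y \<times> U \<and> [y * u' = y' * u] (mod int p)}"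

section \<open>Fourth moment bound and shifted character sums\<close>

context discrete_log
begin

lemma card_shifted_zeros_le: "card {x \<in> {0..<int p}. int p dvd x + a} \<le> 1"
proof -
  have "x = y" if "x \<in> {0..<int p}" "int p dvd x + a" "y \<in> {0..<int p}" "int p dvd y + a" for x y
  proof -
    have "int p dvd (x + a) - (y + a)" using that by (intro dvd_diff)
    then have "x mod int p = y mod int p" by (simp add: mod_eq_dvd_iff)
    then show ?thesis using that by simp
  qed
  then have "card {x \<in> {0..<int p}. int p dvd x + a} \<le> Suc 0"
    by (subst card_le_Suc0_iff_eq) (auto intro: finite_subset[of _ "{0..<int p}"])
  then show ?thesis by simp
qed

text \<open>For \<open>k = 1\<close> the divisibility is vacuous, and each of the four shifts
  excludes at most one residue.\<close>

lemma card_solutions_1_ge: "real (card (solutions 1 a b c d)) \<ge> real p - 4"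
proof -
  define Z where "Z = (\<lambda>a. {x \<in> {0..<int p}. int p dvd x + a})"
  have fin: "finite (Z t)" for t unfolding Z_def by (rule finite_subset[of _ "{0..<int p}"]) auto
  have Z1: "card (Z t) \<le> 1" for t unfolding Z_def by (rule card_shifted_zeros_le)
  have "{0..<int p} \<subseteq> solutions 1 a b c d \<union> (Z a \<union> Z b \<union> (Z c \<union> Z d))"
    by (auto simp: solutions_def Z_def)
  then have "card {0..<int p} \<le> card (solutions 1 a b c d \<union> (Z a \<union> Z b \<union> (Z c \<union> Z d)))"
    by (intro card_mono) (auto simp: fin)
  also have "\<dots> \<le> card (solutions 1 a b c d) + (card (Z a) + card (Z b) + (card (Z c) + card (Z d)))"
    by (meson add_mono card_Un_le le_refl le_trans)
  also have "\<dots> \<le> card (solutions 1 a b c d) + 4" using Z1[of a] Z1[of b] Z1[of c] Z1[of d] by simp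
  finally show ?thesis by simp
qed

text \<open>Quadruples whose entries match in pairs number at most \<open>3 * card V ^ 2\<close> and
  get the trivial bound \<open>p\<close>. For the others the main terms \<open>k * m = p - 1\<close>
  and \<open>p\<close> cancel up to a constant, leaving the error of Stepanov's method.\<close>

lemma fourth_moment_le:
  assumes p: "p \<ge> 100" and km: "k * m = p - 1" and k: "k \<ge> 2" and V: "V \<subseteq> {0..<int p}"
  shows "(\<Sum>j\<in>{1..<k}. \<Sum>x\<in>{0..<int p}. cmod (\<Sum>v\<in>V. char k j (x + v)) ^ 4) \<le>
    real k * (3 * real p * real (card V) ^ 2 + 10 * sqrt (real p) * real (card V) ^ 4)"
proof -
  define N where "N = real (card V)"
  define F where "F = (\<lambda>j. \<Sum>x\<in>{0..<int p}. cmod (\<Sum>v\<in>V. char k j (x + v)) ^ 4)"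
  have finV: "finite V" using V finite_subset by blast
  \<comment> \<open>The principal character is subtracted as the moment with \<open>k = 1\<close>, which has the same main term.\<close>
  have char0: "char k 0 x = char 1 0 x" for x by (simp add: char_def)
  have "{..<k} = insert 0 {1..<k}" using k by auto
  then have "sum F {..<k} = F 0 + sum F {1..<k}" by simp
  then have "sum F {1..<k} = sum F {..<k} - F 0" by simp
  also have "sum F {..<k} = (\<Sum>a\<in>V. \<Sum>b\<in>V. \<Sum>c\<in>V. \<Sum>d\<in>V. real k * real (card (solutions k a b c d)))"
    using fourth_moment_eq[of k V] k finV by (simp add: F_def sum_distrib_left)
  also have "F 0 = (\<Sum>a\<in>V. \<Sum>b\<in>V. \<Sum>c\<in>V. \<Sum>d\<in>V. real (card (solutions 1 a b c d)))"
    using fourth_moment_eq[of 1 V] finV unfolding F_def char0 by simp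
  also have "(\<Sum>a\<in>V. \<Sum>b\<in>V. \<Sum>c\<in>V. \<Sum>d\<in>V. real k * real (card (solutions k a b c d))) -
      (\<Sum>a\<in>V. \<Sum>b\<in>V. \<Sum>c\<in>V. \<Sum>d\<in>V. real (card (solutions 1 a b c d))) =
      (\<Sum>a\<in>V. \<Sum>b\<in>V. \<Sum>c\<in>V. \<Sum>d\<in>V. real k * real (card (solutions k a b c d)) - real (card (solutions 1 a b c d)))"
    by (simp add: sum_subtractf)
  also have "\<dots> \<le> (\<Sum>a\<in>V. \<Sum>b\<in>V. \<Sum>c\<in>V. \<Sum>d\<in>V. 10 * real k * sqrt (real p) + real k * real p *
      (of_bool (a = b) * of_bool (c = d) + of_bool (a = c) * of_bool (b = d) + of_bool (a = d) * of_bool (b = c)))"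
  proof (intro sum_mono)
    fix a b c d assume abcd: "a \<in> V" "b \<in> V" "c \<in> V" "d \<in> V"
    have nd: "\<not> int p dvd s - t" if "s \<in> V" "t \<in> V" "s \<noteq> t" for s t
    proof
      assume "int p dvd s - t"
      then have "s mod int p = t mod int p" by (simp add: mod_eq_dvd_iff)
      then show False using that V by (auto simp: subset_iff)
    qed
    show "real k * real (card (solutions k a b c d)) - real (card (solutions 1 a b c d)) \<le>
       10 * real k * sqrt (real p) + real k * real p *
      (of_bool (a = b) * of_bool (c = d) + of_bool (a = c) * of_bool (b = d) + of_bool (a = d) * of_bool (b = c))"
      (is "?L \<le> _ + _ * ?B")
    proof (cases "(a = b \<and> c = d) \<or> (a = c \<and> b = d) \<or> (a = d \<and> b = c)")
      case True
      then have B: "(1::real) \<le> ?B" by auto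
      have "real k * real (card (solutions k a b c d)) \<le> real k * real p"
        using card_solutions_le_p[of k a b c d] by (intro mult_left_mono) auto
      then have "?L \<le> real k * real p" by linarith
      also have "\<dots> \<le> real k * real p * ?B" using mult_left_mono[OF B, of "real k * real p"] by simp
      finally have "?L \<le> real k * real p * ?B" .
      moreover have "0 \<le> 10 * real k * sqrt (real p)" by simp
      ultimately show ?thesis by linarith
    next
      case False
      \<comment> \<open>If every entry had an equal partner, the quadruple would split into pairs;
        hence some entry differs from the other three. The symmetries of \<open>solutions\<close>
        bring it to the front.\<close>
      then have "(a \<noteq> b \<and> a \<noteq> c \<and> a \<noteq> d) \<or> (b \<noteq> a \<and> b \<noteq> c \<and> b \<noteq> d) \<or>
         (c \<noteq> d \<and> c \<noteq> a \<and> c \<noteq> b) \<or> (d \<noteq> c \<and> d \<noteq> a \<and> d \<noteq> b)" by auto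
      then have "real (card (solutions k a b c d)) \<le> real m + 9 * sqrt (real p)"
      proof (elim disjE)
        assume "a \<noteq> b \<and> a \<noteq> c \<and> a \<noteq> d"
        then show ?thesis using abcd by (intro card_solutions_le[OF p km k] nd) auto
      next
        assume "b \<noteq> a \<and> b \<noteq> c \<and> b \<noteq> d"
        then show ?thesis using abcd
          by (subst solutions_commute) (intro card_solutions_le[OF p km k] nd; auto)
      next
        assume "c \<noteq> d \<and> c \<noteq> a \<and> c \<noteq> b"
        then show ?thesis using abcd
          by (subst solutions_swap) (intro card_solutions_le[OF p km k] nd; auto)
      next
        assume "d \<noteq> c \<and> d \<noteq> a \<and> d \<noteq> b"
        then show ?thesis using abcd
          by (subst solutions_swap, subst solutions_commute) (intro card_solutions_le[OF p km k] nd; auto)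
      qed
      then have "real k * real (card (solutions k a b c d)) \<le> real k * (real m + 9 * sqrt (real p))"
        by (intro mult_left_mono) auto
      also have "\<dots> = real (k * m) + 9 * (real k * sqrt (real p))" by (simp add: algebra_simps)
      also have "real (k * m) = real p - 1" using km p by (simp add: of_nat_diff)
      finally have "?L \<le> 3 + 9 * (real k * sqrt (real p))"
        using card_solutions_1_ge[of a b c d] by linarith
      \<comment> \<open>This absorbs the constant 3 and turns the factor 9 into 10.\<close>
      moreover have "real k * sqrt (real p) \<ge> 2 * 10"
        using k p by (intro mult_mono) (auto intro: real_le_rsqrt)
      moreover have "real k * real p * ?B \<ge> 0" by simp
      ultimately show ?thesis by linarith
    qed
  qed
  also have "\<dots> = real k * (3 * real p * N ^ 2 + 10 * sqrt (real p) * N ^ 4)"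
  proof -
    have one: "(\<Sum>d\<in>V. of_bool (c = d)) = (1 :: real)" if "c \<in> V" for c
      using that finV by (simp add: of_bool_def)
    have "(\<Sum>a\<in>V. \<Sum>b\<in>V. \<Sum>c\<in>V. \<Sum>d\<in>V. (of_bool (a = b) * of_bool (c = d) :: real))
        = (\<Sum>a\<in>V. \<Sum>b\<in>V. of_bool (a = b) * N)"
      by (intro sum.cong refl) (simp only: sum_distrib_left[symmetric] one sum_constant N_def mult_1_right mult.commute cong: sum.cong)
    also have "\<dots> = N ^ 2"
      by (simp only: sum_distrib_right[symmetric] one sum_constant N_def power2_eq_square mult_1_right cong: sum.cong)
    finally have S1: "(\<Sum>a\<in>V. \<Sum>b\<in>V. \<Sum>c\<in>V. \<Sum>d\<in>V. (of_bool (a = b) * of_bool (c = d) :: real)) = N ^ 2" .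
    have S2: "(\<Sum>a\<in>V. \<Sum>b\<in>V. \<Sum>c\<in>V. \<Sum>d\<in>V. (of_bool (a = c) * of_bool (b = d) :: real)) = N ^ 2"
      by (simp only: sum_distrib_left[symmetric] one sum_constant N_def power2_eq_square mult_1_right cong: sum.cong)
    have S3: "(\<Sum>a\<in>V. \<Sum>b\<in>V. \<Sum>c\<in>V. \<Sum>d\<in>V. (of_bool (a = d) * of_bool (b = c) :: real)) = N ^ 2"
      by (simp only: sum_distrib_right[symmetric] one sum_constant N_def power2_eq_square mult_1_right mult_1_left cong: sum.cong)
    have "(\<Sum>a\<in>V. \<Sum>b\<in>V. \<Sum>c\<in>V. \<Sum>d\<in>V. (of_bool (a = b) * of_bool (c = d) +
        of_bool (a = c) * of_bool (b = d) + of_bool (a = d) * of_bool (b = c) :: real)) = 3 * N ^ 2"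
      by (simp only: sum.distrib S1 S2 S3)
    moreover have "(\<Sum>a\<in>V. \<Sum>b\<in>V. \<Sum>c\<in>V. \<Sum>d\<in>V. s + t * f a b c d) =
        s * N ^ 4 + t * (\<Sum>a\<in>V. \<Sum>b\<in>V. \<Sum>c\<in>V. \<Sum>d\<in>V. f a b c d)" for s t :: real and f
      unfolding sum.distrib sum_distrib_left[symmetric] by (simp add: N_def power4_eq_xxxx)
    ultimately have "(\<Sum>a\<in>V. \<Sum>b\<in>V. \<Sum>c\<in>V. \<Sum>d\<in>V. 10 * real k * sqrt (real p) + real k * real p *
      (of_bool (a = b) * of_bool (c = d) + of_bool (a = c) * of_bool (b = d) + of_bool (a = d) * of_bool (b = c))) =
      10 * real k * sqrt (real p) * N ^ 4 + real k * real p * (3 * N ^ 2)" by (simp only:)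
    then show ?thesis by (simp only: distrib_left mult_ac add_ac)
  qed
  finally show ?thesis by (simp add: F_def N_def)
qed

text \<open>Writing \<open>y + u * v = u * (y / u + v)\<close> removes \<open>u\<close> from the
  inner modulus. Two applications of Cauchy-Schwarz, first over \<open>(j, y, u)\<close> and then
  over \<open>(j, x)\<close>, separate the energy from the fourth moment.\<close>

lemma char_sum_bound:
  assumes p: "p \<ge> 100" and km: "k * m = p - 1" and k: "k \<ge> 2" and V: "V \<subseteq> {0..<int p}"
    and Y: "finite Y" and U: "finite U" "\<And>u. u \<in> U \<Longrightarrow> \<not> int p dvd u"
  shows "(\<Sum>j\<in>{1..<k}. cmod (\<Sum>(y, u)\<in>Y \<times> U. \<Sum>v\<in>V. char k j (y + u * v))) ^ 4 \<le>
    real k ^ 4 * (real (card Y) * real (card U)) ^ 2 * real (mult_energy p Y U) *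
     (3 * real p * real (card V) ^ 2 + 10 * sqrt (real p) * real (card V) ^ 4)"
proof -
  define Q where "Q = Y \<times> U"
  define J where "J = {1..<k}"
  define X where "X = {0..<int p}"
  define W where "W = 3 * real p * real (card V) ^ 2 + 10 * sqrt (real p) * real (card V) ^ 4"
  have finQ: "finite Q" using Y U by (simp add: Q_def)
  have cardQ: "card Q = card Y * card U" by (simp add: Q_def card_cartesian_product)
  have kdvd: "k dvd p - 1" using km by (metis dvd_triv_left)
  have "\<exists>w. [u * w = 1] (mod int p)" if "u \<in> U" for u
  proof -
    have "coprime u (int p)" using prime_imp_coprime[OF prime_int U(2)[OF that]] by (simp add: coprime_commute)
    then show ?thesis by (rule cong_solve_coprime_int)
  qed
  then obtain iv where iv: "\<And>u. u \<in> U \<Longrightarrow> [u * iv u = 1] (mod int p)" by metis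
  \<comment> \<open>The residue \<open>y / u\<close>, with \<open>iv u\<close> the inverse of
    \<open>u\<close> modulo \<open>p\<close>.\<close>
  define f where "f = (\<lambda>(y, u). (y * iv u) mod int p)"
  have fX: "f q \<in> X" for q using p_gt_1 by (auto simp: f_def X_def split: prod.split)
  have uf: "[u * f (y, u) = y] (mod int p)" if "u \<in> U" for y u
  proof -
    have "[u * f (y, u) = u * (y * iv u)] (mod int p)" by (simp add: f_def cong_def mod_mult_right_eq)
    also have "u * (y * iv u) = y * (u * iv u)" by simp
    also have "[\<dots> = y * 1] (mod int p)" by (intro cong_mult cong_refl iv that)
    finally show ?thesis by simp
  qed
  define a where "a = (\<lambda>j x. cmod (\<Sum>v\<in>V. char k j (x + v)))"
  define N where "N = (\<lambda>x. real (card {q. q \<in> Q \<and> f q = x}))"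
  have T: "cmod (\<Sum>(y, u)\<in>Q. \<Sum>v\<in>V. char k j (y + u * v)) \<le> (\<Sum>q\<in>Q. a j (f q))" for j
  proof -
    have "cmod (\<Sum>v\<in>V. char k j (y + u * v)) \<le> a j (f (y, u))" if "(y, u) \<in> Q" for y u
    proof -
      have "char k j (y + u * v) = char k j u * char k j (f (y, u) + v)" for v
      proof -
        have "[y + u * v = u * f (y, u) + u * v] (mod int p)"
          using uf that by (intro cong_add cong_refl) (auto simp: Q_def cong_sym)
        then have "char k j (y + u * v) = char k j (u * (f (y, u) + v))"
          by (intro char_cong) (simp add: distrib_left)
        then show ?thesis by (simp add: char_mult[OF kdvd])
      qed
      then have "(\<Sum>v\<in>V. char k j (y + u * v)) = char k j u * (\<Sum>v\<in>V. char k j (f (y, u) + v))"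
        by (simp add: sum_distrib_left)
      then show ?thesis using mult_right_mono[OF norm_char_le[of k j u], of "a j (f (y, u))"]
        by (simp add: a_def norm_mult)
    qed
    then show ?thesis by (intro sum_norm_le) auto
  qed
  define S1 where "S1 = (\<Sum>(j, q)\<in>J \<times> Q. a j (f q))"
  define S2 where "S2 = (\<Sum>(j, q)\<in>J \<times> Q. a j (f q) ^ 2)"
  have "(\<Sum>j\<in>J. cmod (\<Sum>(y, u)\<in>Q. \<Sum>v\<in>V. char k j (y + u * v))) \<le> S1"
    unfolding S1_def sum.cartesian_product[symmetric] by (intro sum_mono T)
  then have "(\<Sum>j\<in>J. cmod (\<Sum>(y, u)\<in>Q. \<Sum>v\<in>V. char k j (y + u * v))) ^ 4 \<le> S1 ^ 4"
    by (intro power_mono sum_nonneg) auto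
  also have "S1 ^ 4 = (S1 ^ 2) ^ 2" by simp
  also have "S1 ^ 2 \<le> S2 * (real k * real (card Q))"
  proof -
    have "S1 ^ 2 \<le> S2 * real (card (J \<times> Q))"
      unfolding S1_def S2_def using sum_squared_le_sum_of_squares[of "\<lambda>(j, q). a j (f q)" "J \<times> Q"]
      by (simp add: case_prod_beta)
    also have "real (card (J \<times> Q)) \<le> real k * real (card Q)"
      by (simp add: card_cartesian_product J_def mult_right_mono)
    finally show ?thesis by (simp add: S2_def mult_left_mono sum_nonneg case_prod_beta)
  qed
  then have "(S1 ^ 2) ^ 2 \<le> (S2 * (real k * real (card Q))) ^ 2" by (intro power_mono) auto
  also have "\<dots> = S2 ^ 2 * (real k * real (card Q)) ^ 2" by (simp add: power_mult_distrib)
  also have "S2 ^ 2 \<le> (real k * real (mult_energy p Y U)) * (real k * W)"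
  proof -
    have "S2 = (\<Sum>j\<in>J. \<Sum>x\<in>X. N x * a j x ^ 2)"
    proof -
      have "(\<Sum>q\<in>Q. a j (f q) ^ 2) = (\<Sum>x\<in>X. N x * a j x ^ 2)" for j
      proof -
        have "(\<Sum>q\<in>Q. a j (f q) ^ 2) = (\<Sum>x\<in>X. \<Sum>q\<in>{q. q \<in> Q \<and> f q = x}. a j (f q) ^ 2)"
          by (rule sum.group[symmetric]) (use finQ fX in \<open>auto simp: X_def\<close>)
        also have "\<dots> = (\<Sum>x\<in>X. N x * a j x ^ 2)" by (simp add: N_def)
        finally show ?thesis .
      qed
      then show ?thesis by (simp add: S2_def sum.cartesian_product[symmetric])
    qed
    also have "\<dots> = (\<Sum>(j, x)\<in>J \<times> X. N x * a j x ^ 2)" by (simp add: sum.cartesian_product)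
    finally have "S2 ^ 2 \<le> (\<Sum>(j, x)\<in>J \<times> X. N x ^ 2) * (\<Sum>(j, x)\<in>J \<times> X. (a j x ^ 2) ^ 2)"
      using Cauchy_Schwarz_ineq_sum[of "\<lambda>(j, x). N x" "\<lambda>(j, x). a j x ^ 2" "J \<times> X"]
      by (simp add: case_prod_beta)
    also have "\<dots> \<le> (real k * real (mult_energy p Y U)) * (real k * W)"
    proof (rule mult_mono)
      \<comment> \<open>\<open>N x\<close> counts representations of \<open>x\<close> as
        \<open>y / u\<close>, so its square counts pairs in one fibre of \<open>f\<close>; such
        pairs satisfy \<open>y * u' = y' * u\<close> modulo \<open>p\<close>.\<close>
      have "(\<Sum>x\<in>X. N x ^ 2) = real (\<Sum>x\<in>X. card ({q. q \<in> Q \<and> f q = x} \<times> {q. q \<in> Q \<and> f q = x}))"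
        by (simp add: N_def card_cartesian_product power2_eq_square)
      also have "(\<Sum>x\<in>X. card ({q. q \<in> Q \<and> f q = x} \<times> {q. q \<in> Q \<and> f q = x})) =
          card (\<Union>x\<in>X. {q. q \<in> Q \<and> f q = x} \<times> {q. q \<in> Q \<and> f q = x})"
        by (rule card_UN_disjoint[symmetric]) (use finQ in \<open>auto simp: X_def\<close>)
      also have "\<dots> \<le> mult_energy p Y U"
        unfolding mult_energy_def
      proof (rule card_mono)
        show "finite {((y, u), (y', u')). (y, u) \<in> Y \<times> U \<and> (y', u') \<in> Y \<times> U \<and> [y * u' = y' * u] (mod int p)}"
          by (rule finite_subset[of _ "Q \<times> Q"]) (use finQ in \<open>auto simp: Q_def\<close>)
        show "(\<Union>x\<in>X. {q. q \<in> Q \<and> f q = x} \<times> {q. q \<in> Q \<and> f q = x}) \<subseteq>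
          {((y, u), (y', u')). (y, u) \<in> Y \<times> U \<and> (y', u') \<in> Y \<times> U \<and> [y * u' = y' * u] (mod int p)}"
        proof clarsimp
          fix y u y' u' assume q: "(y, u) \<in> Q" "(y', u') \<in> Q" and eq: "f (y', u') = f (y, u)"
          have uU: "u \<in> U" "u' \<in> U" using q by (auto simp: Q_def)
          have "[y * u' = (u * f (y, u)) * u'] (mod int p)"
            using uf[OF uU(1)] by (intro cong_mult cong_refl) (rule cong_sym)
          also have "(u * f (y, u)) * u' = (u' * f (y', u')) * u" using eq by simp
          also have "[\<dots> = y' * u] (mod int p)" using uf[OF uU(2)] by (intro cong_mult cong_refl)
          finally show "y \<in> Y \<and> u \<in> U \<and> y' \<in> Y \<and> u' \<in> U \<and> [y * u' = y' * u] (mod int p)"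
            using q by (auto simp: Q_def)
        qed
      qed
      finally have "(\<Sum>x\<in>X. N x ^ 2) \<le> real (mult_energy p Y U)" by simp
      then have "real (card J) * (\<Sum>x\<in>X. N x ^ 2) \<le> real k * real (mult_energy p Y U)"
        by (intro mult_mono sum_nonneg) (auto simp: J_def)
      then show "(\<Sum>(j, x)\<in>J \<times> X. N x ^ 2) \<le> real k * real (mult_energy p Y U)"
        by (simp add: sum.cartesian_product[symmetric])
      show "(\<Sum>(j, x)\<in>J \<times> X. (a j x ^ 2) ^ 2) \<le> real k * W"
        using fourth_moment_le[OF p km k V]
        by (simp add: sum.cartesian_product[symmetric] a_def J_def X_def W_def)
    qed (auto intro!: sum_nonneg simp: case_prod_beta)
    finally show ?thesis .
  qed
  then have "S2 ^ 2 * (real k * real (card Q)) ^ 2 \<le>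
     (real k * real (mult_energy p Y U)) * (real k * W) * (real k * real (card Q)) ^ 2"
    by (intro mult_right_mono) auto
  also have "\<dots> = real k ^ 4 * real (card Q) ^ 2 * real (mult_energy p Y U) * W"
    by (simp add: power_mult_distrib power2_eq_square power4_eq_xxxx mult_ac)
  finally show ?thesis by (simp add: Q_def[symmetric] J_def W_def cardQ)
qed

end

section \<open>Bohr sets\<close>

text \<open>The usual Bohr set of width \<open>R / p\<close>, with integer representatives in place
  of distances so that congruences between small integers can be turned into equalities.\<close>

definition bohr :: "nat \<Rightarrow> int set \<Rightarrow> int \<Rightarrow> int set" where
  "bohr p \<Gamma> R = {x \<in> {0..<int p}. \<forall>r\<in>\<Gamma>. \<exists>s. \<bar>s\<bar> \<le> R \<and> [x * r = s] (mod int p)}"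

lemma finite_bohr [simp]: "finite (bohr p \<Gamma> R)"
  unfolding bohr_def by (rule finite_subset[of _ "{0..<int p}"]) auto

lemma bohr_subset: "bohr p \<Gamma> R \<subseteq> {0..<int p}"
  by (auto simp: bohr_def)

lemma bohrE:
  assumes "x \<in> bohr p \<Gamma> R" "r \<in> \<Gamma>"
  obtains s where "\<bar>s\<bar> \<le> R" "[x * r = s] (mod int p)"
  using assms by (auto simp: bohr_def)

lemma cong_small_imp_eq:
  fixes a b :: int
  assumes "[a = b] (mod int p)" "\<bar>a - b\<bar> < int p"
  shows "a = b"
proof (rule ccontr)
  assume "a \<noteq> b"
  moreover have "int p dvd a - b" using assms(1) by (simp add: cong_iff_dvd_diff)
  ultimately have "int p \<le> \<bar>a - b\<bar>" using dvd_imp_le_int[of "a - b" "int p"] by simp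
  then show False using assms(2) by simp
qed

text \<open>The residues \<open>x * r\<close> are sorted into boxes of side \<open>R + 1\<close>, at
  most \<open>p div (R + 1) + 1\<close> of them in each direction. Two points of one box differ by
  an element of the Bohr set, so no box holds more points than that set.\<close>

lemma card_bohr_ge:
  fixes R :: int
  assumes p: "p > 0" and R: "R \<ge> 0" and \<Gamma>: "finite \<Gamma>"
  shows "int p \<le> (int p div (R + 1) + 1) ^ card \<Gamma> * int (card (bohr p \<Gamma> R))"
proof -
  define Q where "Q = int p div (R + 1) + 1"
  define f where "f = (\<lambda>x. \<lambda>r\<in>\<Gamma>. (x * r mod int p) div (R + 1))"
  define T where "T = PiE \<Gamma> (\<lambda>_. {0..<Q})"
  have finT: "finite T" using \<Gamma> by (simp add: T_def finite_PiE)
  have fT: "f ` {0..<int p} \<subseteq> T"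
  proof -
    have "0 \<le> (y mod int p) div (R + 1)" "(y mod int p) div (R + 1) < Q" for y
    proof -
      show "0 \<le> (y mod int p) div (R + 1)" using p R by (simp add: pos_imp_zdiv_nonneg_iff)
      have "(y mod int p) div (R + 1) \<le> int p div (R + 1)"
        using p R by (intro zdiv_mono1) (auto intro: less_imp_le)
      then show "(y mod int p) div (R + 1) < Q" by (simp add: Q_def)
    qed
    then show ?thesis by (auto simp: f_def T_def)
  qed
  have fiber: "card {x \<in> {0..<int p}. f x = t} \<le> card (bohr p \<Gamma> R)" for t
  proof (cases "{x \<in> {0..<int p}. f x = t} = {}")
    case True
    then show ?thesis by (simp only: card.empty)
  next
    case False
    then obtain x0 where x0: "x0 \<in> {0..<int p}" "f x0 = t" by auto
    show ?thesis
    proof (rule card_inj_on_le[where f = "\<lambda>x. (x - x0) mod int p"])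
      show "inj_on (\<lambda>x. (x - x0) mod int p) {x \<in> {0..<int p}. f x = t}"
      proof (rule inj_onI, clarsimp)
        fix x y assume "0 \<le> x" "x < int p" "0 \<le> y" "y < int p" "(x - x0) mod int p = (y - x0) mod int p"
        then show "x = y"
          by (intro cong_small_imp_eq[of x y p]) (auto simp: cong_iff_dvd_diff mod_eq_dvd_iff)
      qed
      show "(\<lambda>x. (x - x0) mod int p) ` {x \<in> {0..<int p}. f x = t} \<subseteq> bohr p \<Gamma> R"
      proof clarsimp
        fix x assume x: "0 \<le> x" "x < int p" "t = f x"
        have "\<exists>s. \<bar>s\<bar> \<le> R \<and> [((x - x0) mod int p) * r = s] (mod int p)" if r: "r \<in> \<Gamma>" for r
        proof (intro exI conjI)
          define a b where "a = x * r mod int p" and "b = x0 * r mod int p"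
          have "f x r = f x0 r" using x x0 by simp
          then have "a div (R + 1) = b div (R + 1)" using r by (simp add: f_def a_def b_def)
          then have "a - b = a mod (R + 1) - b mod (R + 1)"
            by (simp add: minus_mult_div_eq_mod[symmetric])
          moreover have "0 \<le> y mod (R + 1) \<and> y mod (R + 1) < R + 1" for y
            using pos_mod_sign[of "R + 1" y] pos_mod_bound[of "R + 1" y] R by linarith
          then have "0 \<le> a mod (R + 1)" "a mod (R + 1) < R + 1" "0 \<le> b mod (R + 1)" "b mod (R + 1) < R + 1"
            by blast+
          ultimately show "\<bar>a - b\<bar> \<le> R" by linarith
          show "[((x - x0) mod int p) * r = a - b] (mod int p)"
            unfolding a_def b_def cong_def
            by (simp add: mod_mult_left_eq mod_diff_eq left_diff_distrib)
        qed
        then show "(x - x0) mod int p \<in> bohr p \<Gamma> R" using p by (simp add: bohr_def)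
      qed
    qed simp
  qed
  have "p = (\<Sum>x\<in>{0..<int p}. 1)" by simp
  also have "\<dots> = (\<Sum>t\<in>T. \<Sum>x\<in>{x. x \<in> {0..<int p} \<and> f x = t}. 1)"
    by (rule sum.group[symmetric]) (use finT fT in auto)
  also have "\<dots> = (\<Sum>t\<in>T. card {x \<in> {0..<int p}. f x = t})" by simp
  also have "\<dots> \<le> card T * card (bohr p \<Gamma> R)"
    using sum_bounded_above[of T "\<lambda>t. card {x \<in> {0..<int p}. f x = t}" "card (bohr p \<Gamma> R)"] fiber by simp
  finally have "int p \<le> int (card T) * int (card (bohr p \<Gamma> R))" by (metis of_nat_le_iff of_nat_mult)
  moreover have "Q \<ge> 0" using p R by (simp add: Q_def pos_imp_zdiv_nonneg_iff)
  then have "int (card T) = Q ^ card \<Gamma>" by (simp add: T_def card_PiE \<Gamma>)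
  ultimately show ?thesis by (simp add: Q_def)
qed

lemma bohr_add_mult:
  assumes x: "x \<in> bohr p \<Gamma> R" and y: "y \<in> bohr p \<Gamma> R'" and p: "p > 0" and R: "R + \<bar>u\<bar> * R' \<le> R''"
  shows "(x + u * y) mod int p \<in> bohr p \<Gamma> R''"
proof -
  have "\<exists>s. \<bar>s\<bar> \<le> R'' \<and> [((x + u * y) mod int p) * r = s] (mod int p)" if r: "r \<in> \<Gamma>" for r
  proof -
    obtain s t where s: "\<bar>s\<bar> \<le> R" "[x * r = s] (mod int p)" and t: "\<bar>t\<bar> \<le> R'" "[y * r = t] (mod int p)"
      using bohrE[OF x r] bohrE[OF y r] by metis
    have "\<bar>s + u * t\<bar> \<le> \<bar>s\<bar> + \<bar>u\<bar> * \<bar>t\<bar>" using abs_triangle_ineq[of s "u * t"] by (simp add: abs_mult)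
    also have "\<dots> \<le> R + \<bar>u\<bar> * R'" using s t by (intro add_mono mult_left_mono) auto
    finally have "\<bar>s + u * t\<bar> \<le> R''" using R by simp
    moreover have "[((x + u * y) mod int p) * r = (x + u * y) * r] (mod int p)"
      by (simp add: cong_def mod_mult_left_eq)
    moreover have "[x * r + u * (y * r) = s + u * t] (mod int p)"
      using s t by (intro cong_add cong_mult cong_refl)
    then have "[(x + u * y) * r = s + u * t] (mod int p)" by (simp add: algebra_simps)
    ultimately show ?thesis using cong_trans by blast
  qed
  then show ?thesis using p by (simp add: bohr_def)
qed

text \<open>The smaller Bohr set is translated by the multiples \<open>3 * j * z\<close> of one of
  its own elements. With \<open>z\<close> extremal in some coordinate \<open>r0\<close>, consecutive
  translates are \<open>3 * s\<close> apart there while each has width at most \<open>2 * s\<close>,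
  so they are disjoint.\<close>

lemma bohr_packing:
  fixes J :: nat and R R' :: int
  assumes p: "prime p" and \<Gamma>: "finite \<Gamma>" "r1 \<in> \<Gamma>" "\<not> int p dvd r1"
    and R: "3 * int J * R' \<le> R" "R < int p" and R': "R' \<ge> 0" and big: "card (bohr p \<Gamma> R') > 1"
  shows "J * card (bohr p \<Gamma> R') \<le> card (bohr p \<Gamma> R)"
proof (cases "J = 0")
  case False
  define X where "X = bohr p \<Gamma> R'"
  have "\<forall>x\<in>X. \<forall>r\<in>\<Gamma>. \<exists>s. \<bar>s\<bar> \<le> R' \<and> [x * r = s] (mod int p)" by (auto simp: X_def bohr_def)
  then obtain c where c: "\<And>x r. x \<in> X \<Longrightarrow> r \<in> \<Gamma> \<Longrightarrow> \<bar>c x r\<bar> \<le> R'"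
      "\<And>x r. x \<in> X \<Longrightarrow> r \<in> \<Gamma> \<Longrightarrow> [x * r = c x r] (mod int p)" by metis
  define A where "A = (\<lambda>(x, r). \<bar>c x r\<bar>) ` (X \<times> \<Gamma>)"
  \<comment> \<open>The largest coordinate actually attained, which may be smaller than
    \<open>R'\<close>; measuring in units of \<open>s\<close> is what separates the
    translates.\<close>
  define s where "s = Max A"
  have X: "finite X" "X \<noteq> {}" using big by (auto simp: X_def)
  have A: "finite A" "A \<noteq> {}" using X \<Gamma> by (auto simp: A_def)
  have cs: "\<bar>c x r\<bar> \<le> s" if "x \<in> X" "r \<in> \<Gamma>" for x r
    unfolding s_def by (rule Max_ge[OF A(1)]) (use that in \<open>auto simp: A_def\<close>)
  have "s \<in> A" unfolding s_def by (rule Max_in[OF A])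
  then obtain z r0 where z: "z \<in> X" "r0 \<in> \<Gamma>" "s = \<bar>c z r0\<bar>" by (auto simp: A_def)
  have sR: "s \<le> R'" using c(1) z by auto
  \<comment> \<open>If all coordinates vanished, invertibility of \<open>r1\<close> would force the
    Bohr set to be \<open>{0}\<close>, against \<open>big\<close>.\<close>
  have s0: "s > 0"
  proof (rule ccontr)
    assume "\<not> s > 0"
    have "x = 0" if x: "x \<in> X" for x
    proof -
      have "c x r1 = 0" using cs[OF x \<Gamma>(2)] \<open>\<not> s > 0\<close> by simp
      then have "int p dvd x * r1" using c(2)[OF x \<Gamma>(2)] by (simp add: cong_0_iff)
      then have "int p dvd x" using p \<Gamma>(3) by (simp add: prime_dvd_mult_iff)
      moreover have "0 \<le> x" "x < int p" using x by (auto simp: X_def bohr_def)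
      ultimately show ?thesis using zdvd_not_zless[of x "int p"] by fastforce
    qed
    then have "X \<subseteq> {0}" by blast
    then have "card X \<le> 1" using card_mono[of "{0}" X] by simp
    then show False using big by (simp add: X_def)
  qed
  have bound: "2 * s + 3 * int (J - 1) * s < int p" "s + 3 * int (J - 1) * s \<le> R"
  proof -
    have "2 * s + 3 * int (J - 1) * s \<le> 3 * int J * s" using False s0 by (simp add: of_nat_diff algebra_simps)
    also have "\<dots> \<le> 3 * int J * R'" using sR by (intro mult_left_mono) auto
    also note R(1)
    finally have *: "2 * s + 3 * int (J - 1) * s \<le> R" .
    show "2 * s + 3 * int (J - 1) * s < int p" using * R(2) by simp
    show "s + 3 * int (J - 1) * s \<le> R" using * s0 by simp
  qed
  have "card (X \<times> {..<J}) \<le> card (bohr p \<Gamma> R)"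
  proof (rule card_inj_on_le[where f = "\<lambda>(x, j). (x + 3 * int j * z) mod int p"])
    show "inj_on (\<lambda>(x, j). (x + 3 * int j * z) mod int p) (X \<times> {..<J})"
    proof (rule inj_onI, clarsimp)
      fix x j y i assume xy: "x \<in> X" "y \<in> X" and ij: "j < J" "i < J"
        and eq: "(x + 3 * int j * z) mod int p = (y + 3 * int i * z) mod int p"
      then have "[(x + 3 * int j * z) * r0 = (y + 3 * int i * z) * r0] (mod int p)"
        by (intro cong_mult cong_refl) (simp add: cong_def)
      then have *: "[x * r0 + 3 * int j * (z * r0) = y * r0 + 3 * int i * (z * r0)] (mod int p)"
        by (simp add: algebra_simps)
      have "[c x r0 + 3 * int j * c z r0 = x * r0 + 3 * int j * (z * r0)] (mod int p)"
        using c(2) xy z by (intro cong_add cong_mult cong_refl) (auto intro: cong_sym)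
      also note *
      also have "[y * r0 + 3 * int i * (z * r0) = c y r0 + 3 * int i * c z r0] (mod int p)"
        using c(2) xy z by (intro cong_add cong_mult cong_refl) auto
      finally have "[c x r0 + 3 * int j * c z r0 = c y r0 + 3 * int i * c z r0] (mod int p)" .
      moreover have "\<bar>(c x r0 + 3 * int j * c z r0) - (c y r0 + 3 * int i * c z r0)\<bar> < int p"
      proof -
        have "(c x r0 + 3 * int j * c z r0) - (c y r0 + 3 * int i * c z r0)
            = (c x r0 - c y r0) + 3 * (int j - int i) * c z r0" by (simp add: algebra_simps)
        moreover have "\<bar>3 * (int j - int i) * c z r0\<bar> \<le> 3 * int (J - 1) * s"
          using ij z(3) by (simp add: abs_mult mult_right_mono)
        ultimately show ?thesis using cs[OF xy(1) z(2)] cs[OF xy(2) z(2)] bound(1) by linarith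
      qed
      ultimately have e: "c x r0 + 3 * int j * c z r0 = c y r0 + 3 * int i * c z r0"
        by (rule cong_small_imp_eq)
      have "j = i"
      proof (rule ccontr)
        assume "j \<noteq> i"
        have "3 * s * 1 \<le> 3 * s * \<bar>int j - int i\<bar>" using \<open>j \<noteq> i\<close> s0 by (intro mult_left_mono) auto
        also have "\<dots> = \<bar>3 * (int j - int i) * c z r0\<bar>" by (simp only: abs_mult z(3) abs_numeral mult_ac)
        also have "3 * (int j - int i) * c z r0 = c y r0 - c x r0" using e by (simp add: algebra_simps)
        also have "\<bar>c y r0 - c x r0\<bar> \<le> 2 * s" using cs[OF xy(1) z(2)] cs[OF xy(2) z(2)] by linarith
        finally show False using s0 by simp
      qed
      then have "[x = y] (mod int p)" using eq by (metis cong_add_rcancel cong_def)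
      then have "x = y" using xy by (auto simp: X_def bohr_def cong_def)
      then show "x = y \<and> j = i" using \<open>j = i\<close> by simp
    qed
    show "(\<lambda>(x, j). (x + 3 * int j * z) mod int p) ` (X \<times> {..<J}) \<subseteq> bohr p \<Gamma> R"
    proof clarsimp
      fix x j assume x: "x \<in> X" and j: "j < J"
      have b: "y \<in> bohr p \<Gamma> s" if "y \<in> X" for y
      proof -
        have "\<forall>r\<in>\<Gamma>. \<bar>c y r\<bar> \<le> s \<and> [y * r = c y r] (mod int p)" using that c(2) cs by blast
        moreover have "y \<in> {0..<int p}" using that bohr_subset unfolding X_def by blast
        ultimately show ?thesis by (auto simp: bohr_def)
      qed
      have "s + \<bar>3 * int j\<bar> * s \<le> s + 3 * int (J - 1) * s"
        using j s0 by (intro add_left_mono mult_right_mono) auto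
      then have "s + \<bar>3 * int j\<bar> * s \<le> R" using bound(2) by linarith
      then show "(x + 3 * int j * z) mod int p \<in> bohr p \<Gamma> R"
        using p prime_gt_0_nat by (intro bohr_add_mult[OF b[OF x] b[OF z(1)]]) auto
    qed
  qed simp
  then show ?thesis by (simp add: card_cartesian_product X_def mult.commute)
qed simp

text \<open>The \<open>H\<close> diagonal pairs \<open>u = u'\<close> contribute
  \<open>card Y\<close> each. Every other pair contributes at most \<open>card Z\<close>, where
  \<open>Z\<close> has radius smaller by the factor \<open>H\<close>, and packing gives
  \<open>H * card Z \<le> 6 * card Y\<close>; this makes 7 in total.\<close>

lemma mult_energy_bohr_le:
  fixes H :: nat and R :: int
  assumes p: "prime p" and \<Gamma>: "finite \<Gamma>" "r1 \<in> \<Gamma>" "\<not> int p dvd r1"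
    and H: "H \<ge> 3" and R: "R \<ge> 0" "2 * int (H ^ 2 + H) * R < int p" "R < int p"
    and Hp: "H ^ 2 + H < p" and HY: "H \<le> card (bohr p \<Gamma> R)"
    and U: "U = {int (H ^ 2) + 1..int (H ^ 2 + H)}"
  shows "mult_energy p (bohr p \<Gamma> R) U \<le> 7 * (card (bohr p \<Gamma> R) * H)"
proof -
  define Y where "Y = bohr p \<Gamma> R"
  define Z where "Z = bohr p \<Gamma> (R div int H)"
  define E where "E = (\<lambda>u u'. {(y, y'). y \<in> Y \<and> y' \<in> Y \<and> [y * u' = y' * u] (mod int p)})"
  have pint: "prime (int p)" using p by simp
  have cardU: "card U = H" by (simp add: U)
  have finY: "finite Y" by (simp add: Y_def)
  have finE: "finite (E u u')" for u u'
    by (rule finite_subset[of _ "Y \<times> Y"]) (use finY in \<open>auto simp: E_def\<close>)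
  have Ypos: "0 \<le> y" "y < int p" if "y \<in> Y" for y using that by (auto simp: Y_def bohr_def)
  have ndU: "\<not> int p dvd u" and Upos: "u > 0" if "u \<in> U" for u
  proof -
    have "int (H ^ 2) + 1 \<le> u" "u \<le> int (H ^ 2 + H)" using that by (simp_all only: U atLeastAtMost_iff)
    moreover have "int (H ^ 2 + H) < int p" using Hp by (simp only: of_nat_less_iff)
    ultimately have "0 < u" "u < int p" by linarith+
    then show "\<not> int p dvd u" "u > 0" using zdvd_not_zless by auto
  qed
  have Euu: "card (E u u) \<le> card Y" if u: "u \<in> U" for u
  proof (rule card_inj_on_le[OF _ _ finY])
    show "inj_on fst (E u u)"
    proof (rule inj_onI, clarsimp simp: E_def)
      fix y y' z assume yz: "y \<in> Y" "y' \<in> Y" "z \<in> Y"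
        "[y * u = y' * u] (mod int p)" "[y * u = z * u] (mod int p)"
      then have "[y' * u = z * u] (mod int p)" by (meson cong_sym cong_trans)
      then have "int p dvd (y' - z) * u" by (simp add: cong_iff_dvd_diff left_diff_distrib)
      then have "[y' = z] (mod int p)"
        using ndU[OF u] pint by (auto simp: prime_dvd_mult_iff cong_iff_dvd_diff)
      then show "y' = z" using Ypos[OF yz(2)] Ypos[OF yz(3)] by (simp add: cong_def)
    qed
  qed (auto simp: E_def)
  have Euv: "card (E u v) \<le> card Z" if u: "u \<in> U" and v: "v \<in> U" and uv: "u \<noteq> v" for u v
  proof -
    define g where "g = gcd u v"
    define a where "a = u div g"
    define b where "b = v div g"
    have g0: "g > 0" using Upos[OF u] by (simp add: g_def)
    have ua: "u = g * a" and vb: "v = g * b" by (simp_all add: a_def b_def g_def)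
    have a0: "a > 0" and b0: "b > 0" using Upos[OF u] Upos[OF v] g0 ua vb by (auto simp: zero_less_mult_iff)
    have cop: "coprime a b"
      unfolding a_def b_def g_def using Upos[OF u] by (intro div_gcd_coprime) auto
    have "g dvd u - v" by (simp add: g_def)
    then have "g \<le> \<bar>u - v\<bar>" using uv dvd_imp_le_int[of "u - v" g] g0 by simp
    also have "\<bar>u - v\<bar> < int H" using u v by (auto simp: U)
    finally have gH: "g < int H" .
    \<comment> \<open>The gcd divides a nonzero difference below \<open>H\<close>, whereas
      \<open>u\<close> exceeds \<open>H ^ 2\<close>.\<close>
    have aH: "a \<ge> int H"
    proof (rule ccontr)
      assume "\<not> a \<ge> int H"
      then have "g * a \<le> int H * int H" using gH g0 a0 by (intro mult_mono) auto
      then show False using u ua by (simp add: U power2_eq_square)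
    qed
    have au: "a \<le> u" and bv: "b \<le> v" using ua vb g0 a0 b0 by (simp_all add: mult_le_cancel_right1)
    have ap: "\<not> int p dvd a" using ndU[OF u] ua by auto
    have gp: "\<not> int p dvd g" using ndU[OF u] ua by auto
    have "coprime a (int p)" using prime_imp_coprime[OF pint ap] by (simp add: coprime_commute)
    then obtain w where w: "[a * w = 1] (mod int p)" using cong_solve_coprime_int by blast
    have wa: "[a * (y * w) = y] (mod int p)" for y
      using cong_mult[OF cong_refl[of y] w] by (simp add: mult_ac)
    have "card (E u v) \<le> card Z"
    \<comment> \<open>A solution is encoded by \<open>y / a\<close>, with \<open>w\<close> the
      inverse of \<open>a\<close>; it determines \<open>y\<close>, and then \<open>y'\<close>
      because \<open>u\<close> is invertible.\<close>
    proof (rule card_inj_on_le[where f = "\<lambda>(y, y'). (y * w) mod int p"])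
      show "inj_on (\<lambda>(y, y'). (y * w) mod int p) (E u v)"
      proof (rule inj_onI, clarsimp simp: E_def)
        fix y y' z z' assume yz: "y \<in> Y" "y' \<in> Y" "z \<in> Y" "z' \<in> Y"
          "[y * v = y' * u] (mod int p)" "[z * v = z' * u] (mod int p)"
          "(y * w) mod int p = (z * w) mod int p"
        then have "[a * (y * w) = a * (z * w)] (mod int p)" by (intro cong_mult[OF cong_refl]) (simp add: cong_def)
        then have "[y = z] (mod int p)" using wa by (meson cong_sym cong_trans)
        then have yz1: "y = z" using Ypos[OF yz(1)] Ypos[OF yz(3)] by (simp add: cong_def)
        have "[y' * u = y * v] (mod int p)" using yz(5) by (rule cong_sym)
        also have "[y * v = z' * u] (mod int p)" using yz(6) yz1 by simp
        finally have "[y' * u = z' * u] (mod int p)" .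
        then have "int p dvd (y' - z') * u" by (simp add: cong_iff_dvd_diff left_diff_distrib)
        then have "[y' = z'] (mod int p)"
          using ndU[OF u] pint by (auto simp: prime_dvd_mult_iff cong_iff_dvd_diff)
        then show "y = z \<and> y' = z'" using yz1 Ypos[OF yz(2)] Ypos[OF yz(4)] by (simp add: cong_def)
      qed
      show "(\<lambda>(y, y'). (y * w) mod int p) ` E u v \<subseteq> Z"
      proof (clarsimp simp: E_def)
        fix y y' assume y: "y \<in> Y" "y' \<in> Y" and eq: "[y * v = y' * u] (mod int p)"
        have "int p dvd g * (y * b - y' * a)"
          using eq by (simp add: ua vb cong_iff_dvd_diff algebra_simps)
        then have yb: "[y * b = y' * a] (mod int p)"
          using gp pint by (simp add: prime_dvd_mult_iff cong_iff_dvd_diff)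
        have "\<exists>s. \<bar>s\<bar> \<le> R div int H \<and> [((y * w) mod int p) * r = s] (mod int p)" if r: "r \<in> \<Gamma>" for r
        proof -
          obtain s where s: "\<bar>s\<bar> \<le> R" "[y * r = s] (mod int p)"
            using y(1) r unfolding Y_def by (rule bohrE)
          obtain s' where s': "\<bar>s'\<bar> \<le> R" "[y' * r = s'] (mod int p)"
            using y(2) r unfolding Y_def by (rule bohrE)
          have "[s * b = (y * r) * b] (mod int p)" using s by (intro cong_mult cong_refl) (rule cong_sym)
          also have "(y * r) * b = (y * b) * r" by simp
          also have "[(y * b) * r = (y' * a) * r] (mod int p)" by (rule cong_mult[OF yb cong_refl])
          also have "(y' * a) * r = (y' * r) * a" by simp
          also have "[(y' * r) * a = s' * a] (mod int p)" using s' by (intro cong_mult cong_refl)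
          finally have sb: "[s * b = s' * a] (mod int p)" .
          have "\<bar>s * b - s' * a\<bar> \<le> \<bar>s\<bar> * b + \<bar>s'\<bar> * a"
            using abs_triangle_ineq4[of "s * b" "s' * a"] a0 b0 by (simp add: abs_mult)
          also have "\<dots> \<le> R * v + R * u" using s s' au bv a0 b0 R by (intro add_mono mult_mono) auto
          also have "\<dots> \<le> R * int (H ^ 2 + H) + R * int (H ^ 2 + H)"
            using u v R by (intro add_mono mult_left_mono) (auto simp: U)
          also have "\<dots> < int p" using R(2) by (simp add: algebra_simps)
          \<comment> \<open>Both sides are too small to differ by a nonzero multiple of
            \<open>p\<close>, so the congruence is an equality; coprimality then makes
            \<open>a\<close> divide \<open>s\<close>, and the quotient is at most
            \<open>R div H\<close>.\<close>
          finally have "s * b = s' * a" using sb cong_small_imp_eq by blast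
          then have "a dvd s * b" by simp
          then have "a dvd s" using cop coprime_dvd_mult_left_iff by blast
          then obtain t where t: "s = a * t" by auto
          have "int H * \<bar>t\<bar> \<le> a * \<bar>t\<bar>" using aH by (intro mult_right_mono) auto
          also have "\<dots> \<le> R" using s a0 by (simp add: t abs_mult)
          finally have "(int H * \<bar>t\<bar>) div int H \<le> R div int H"
            using H by (intro zdiv_mono1) auto
          then have tR: "\<bar>t\<bar> \<le> R div int H" using H by simp
          have "[a * (((y * w) mod int p) * r) = a * ((y * w) * r)] (mod int p)"
            by (rule cong_mult[OF cong_refl cong_mult[OF _ cong_refl]]) (simp add: cong_def)
          also have "a * ((y * w) * r) = (a * (y * w)) * r" by (simp only: mult.assoc)
          also have "[(a * (y * w)) * r = y * r] (mod int p)" by (rule cong_mult[OF wa cong_refl])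
          also have "[y * r = a * t] (mod int p)" using s t by simp
          finally have "int p dvd a * ((((y * w) mod int p) * r) - t)"
            by (simp add: cong_iff_dvd_diff right_diff_distrib)
          then have "[((y * w) mod int p) * r = t] (mod int p)"
            using ap pint by (simp add: prime_dvd_mult_iff cong_iff_dvd_diff)
          then show ?thesis using tR by blast
        qed
        then show "(y * w) mod int p \<in> Z" using p prime_gt_0_nat by (simp add: Z_def bohr_def)
      qed
    qed (simp add: Z_def)
    then show ?thesis .
  qed
  have HZ: "H * card Z \<le> 6 * card Y"
  proof (cases "card Z \<le> 1")
    case True
    then have "H * card Z \<le> H * 1" by (rule mult_le_mono2)
    also have "\<dots> \<le> 6 * card Y" using HY by (simp add: Y_def)
    finally show ?thesis .
  next
    case False
    define J where "J = H div 3"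
    have RH: "R div int H \<ge> 0" using R(1) H by (simp add: pos_imp_zdiv_nonneg_iff)
    have "3 * int J * (R div int H) \<le> int H * (R div int H)"
      using RH by (intro mult_right_mono) (auto simp: J_def)
    also have "\<dots> \<le> R" using H by (simp add: minus_mod_eq_mult_div[symmetric])
    finally have "J * card Z \<le> card Y"
      unfolding Y_def Z_def using False R(3) RH
      by (intro bohr_packing[OF p \<Gamma>]) (auto simp: Z_def)
    moreover have "H \<le> 6 * J" using H unfolding J_def by presburger
    then have "H * card Z \<le> 6 * J * card Z" by (rule mult_le_mono1)
    ultimately show ?thesis by linarith
  qed
  have "mult_energy p Y U \<le> (\<Sum>(u, v)\<in>U \<times> U. card (E u v))"
  proof -
    have "mult_energy p Y U = card ((\<lambda>((u, v), (y, y')). ((y, u), (y', v))) ` (SIGMA q:U \<times> U. case q of (u, v) \<Rightarrow> E u v))"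
      unfolding mult_energy_def by (rule arg_cong[where f = card]) (force simp: E_def)
    also have "\<dots> \<le> card (SIGMA q:U \<times> U. case q of (u, v) \<Rightarrow> E u v)"
      by (rule card_image_le) (auto simp: finE U)
    also have "\<dots> = (\<Sum>q\<in>U \<times> U. card (case q of (u, v) \<Rightarrow> E u v))"
      by (rule card_SigmaI) (auto simp: finE U)
    finally show ?thesis by (simp add: case_prod_beta)
  qed
  also have "\<dots> \<le> (\<Sum>(u, v)\<in>U \<times> U. (if u = v then card Y else 0) + card Z)"
    by (intro sum_mono) (auto intro: Euv order.trans[OF Euu le_add1])
  also have "\<dots> = H * card Y + H * (H * card Z)"
    unfolding sum.cartesian_product[symmetric] sum.distrib by (simp add: U sum.delta)
  also have "\<dots> \<le> H * card Y + H * (6 * card Y)" by (intro add_mono mult_le_mono2 HZ order.refl)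
  finally show ?thesis by (simp add: Y_def mult.commute)
qed

section \<open>Sieving for primitive roots\<close>

lemma prod_primes_dvd_iff:
  fixes S :: "nat set"
  assumes "finite S" "\<And>q. q \<in> S \<Longrightarrow> prime q"
  shows "\<Prod>S dvd n \<longleftrightarrow> (\<forall>q\<in>S. q dvd n)"
  using assms
proof (induction S rule: finite_induct)
  case (insert q S)
  have "coprime q (\<Prod>S)"
    using insert by (intro prod_coprime_right primes_coprime) auto
  then have "q * \<Prod>S dvd n \<longleftrightarrow> q dvd n \<and> \<Prod>S dvd n"
    by (meson divides_mult dvd_mult_left dvd_mult_right)
  then show ?case using insert by simp
qed simp

text \<open>The indicator is the product of \<open>1 - of_bool (q dvd n x)\<close>, expanded over
  the subsets of \<open>P\<close>. Each of the \<open>2 ^ card P\<close> terms costs at most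
  \<open>\<Delta>\<close>, and the main term is \<open>card X\<close> times the product of
  \<open>1 - 1 / q\<close>.\<close>

lemma inclusion_exclusion_primes:
  fixes n :: "'a \<Rightarrow> nat" and P :: "nat set" and \<Delta> :: real
  assumes X: "finite X" and P: "finite P" "\<And>q. q \<in> P \<Longrightarrow> prime q"
    and \<Delta>: "\<And>S. S \<subseteq> P \<Longrightarrow> \<bar>real (card {x \<in> X. \<Prod>S dvd n x}) - real (card X) / real (\<Prod>S)\<bar> \<le> \<Delta>"
  shows "real (card {x \<in> X. \<forall>q\<in>P. \<not> q dvd n x}) \<ge> real (card X) / 2 ^ card P - 2 ^ card P * \<Delta>"
proof -
  have expand: "(\<Prod>q\<in>P. 1 - f q) = (\<Sum>S\<in>Pow P. (-1) ^ card S * (\<Prod>q\<in>S. f q))" for f :: "nat \<Rightarrow> real"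
  proof -
    have "(\<Prod>q\<in>P. 1 - f q) = (\<Prod>q\<in>P. (- 1) * f q + 1)" by simp
    also have "\<dots> = (\<Sum>S\<in>Pow P. (\<Prod>q\<in>S. (- 1) * f q) * (\<Prod>q\<in>P - S. 1))" by (rule prod_add[OF P(1)])
    also have "\<dots> = (\<Sum>S\<in>Pow P. (-1) ^ card S * (\<Prod>q\<in>S. f q))"
      by (simp only: prod.distrib prod_constant prod.neutral_const power_one mult_1_right)
    finally show ?thesis .
  qed
  have "(of_bool (\<forall>q\<in>P. \<not> q dvd n x) :: real) = (\<Sum>S\<in>Pow P. (-1) ^ card S * of_bool (\<Prod>S dvd n x))" for x
  proof -
    have "(\<Prod>q\<in>S. of_bool (q dvd n x)) = (of_bool (\<Prod>S dvd n x) :: real)" if "S \<subseteq> P" for S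
    proof -
      have "finite S" using that P finite_subset by blast
      then have "(\<Prod>q\<in>S. of_bool (q dvd n x)) = (of_bool (\<forall>q\<in>S. q dvd n x) :: real)"
        by (induction S rule: finite_induct) (auto simp: of_bool_def)
      then show ?thesis using prod_primes_dvd_iff[OF \<open>finite S\<close>] that P by (simp add: subset_iff)
    qed
    then have "(\<Sum>S\<in>Pow P. (-1) ^ card S * of_bool (\<Prod>S dvd n x)) = (\<Prod>q\<in>P. 1 - of_bool (q dvd n x) :: real)"
      unfolding expand by (intro sum.cong) auto
    also have "\<dots> = of_bool (\<forall>q\<in>P. \<not> q dvd n x)"
      using P(1) by (induction P rule: finite_induct) (auto simp: of_bool_def)
    finally show ?thesis by simp
  qed
  then have "(\<Sum>x\<in>X. of_bool (\<forall>q\<in>P. \<not> q dvd n x)) = (\<Sum>S\<in>Pow P. \<Sum>x\<in>X. (-1) ^ card S * (of_bool (\<Prod>S dvd n x) :: real))"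
    by (simp only: sum.swap[of _ "Pow P" X])
  moreover have "(\<Sum>x\<in>X. of_bool (Q x)) = real (card {x \<in> X. Q x})" for Q
    using X by (simp add: of_bool_def sum.If_cases Int_def)
  ultimately have count: "real (card {x \<in> X. \<forall>q\<in>P. \<not> q dvd n x}) =
      (\<Sum>S\<in>Pow P. (-1) ^ card S * real (card {x \<in> X. \<Prod>S dvd n x}))"
    by (simp only: sum_distrib_left[symmetric])
  define M where "M = real (card X) * (\<Prod>q\<in>P. 1 - 1 / real q)"
  have "M = (\<Sum>S\<in>Pow P. (-1) ^ card S * (real (card X) / real (\<Prod>S)))"
    unfolding M_def expand sum_distrib_left by (intro sum.cong refl) (simp add: prod_dividef)
  then have "M - real (card {x \<in> X. \<forall>q\<in>P. \<not> q dvd n x}) =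
      (\<Sum>S\<in>Pow P. (-1) ^ card S * (real (card X) / real (\<Prod>S) - real (card {x \<in> X. \<Prod>S dvd n x})))"
    by (simp only: count right_diff_distrib sum_subtractf)
  also have "\<dots> \<le> (\<Sum>S\<in>Pow P. \<Delta>)"
  proof (intro sum_mono)
    fix S assume "S \<in> Pow P"
    then have "\<bar>real (card X) / real (\<Prod>S) - real (card {x \<in> X. \<Prod>S dvd n x})\<bar> \<le> \<Delta>"
      using \<Delta>[of S] by (simp add: abs_minus_commute)
    then have "\<bar>(-1) ^ card S * (real (card X) / real (\<Prod>S) - real (card {x \<in> X. \<Prod>S dvd n x}))\<bar> \<le> \<Delta>"
      by (simp only: abs_mult power_abs abs_minus_cancel abs_one power_one mult_1_left)
    then show "(-1) ^ card S * (real (card X) / real (\<Prod>S) - real (card {x \<in> X. \<Prod>S dvd n x})) \<le> \<Delta>"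
      by linarith
  qed
  also have "\<dots> = 2 ^ card P * \<Delta>" using P by (simp add: card_Pow)
  finally have "real (card {x \<in> X. \<forall>q\<in>P. \<not> q dvd n x}) \<ge> M - 2 ^ card P * \<Delta>" by linarith
  \<comment> \<open>A crude bound, with every prime treated as 2; a power saving in
    \<open>\<Delta>\<close> can afford it.\<close>
  moreover have "real (card X) / 2 ^ card P \<le> M"
  proof -
    have "(\<Prod>q\<in>P. 1 / 2) \<le> (\<Prod>q\<in>P. 1 - 1 / real q)"
    proof (rule prod_mono)
      fix q assume "q \<in> P"
      then have "q \<ge> 2" using P(2) prime_ge_2_nat by blast
      then show "0 \<le> (1/2 :: real) \<and> 1 / 2 \<le> 1 - 1 / real q" by (simp add: field_simps)
    qed
    then have "(1 / 2) ^ card P \<le> (\<Prod>q\<in>P. 1 - 1 / real q)" by simp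
    from mult_left_mono[OF this, of "real (card X)"] show ?thesis by (simp add: M_def power_one_over)
  qed
  ultimately show ?thesis by linarith
qed

text \<open>At most \<open>T\<close> prime factors lie below \<open>T\<close>, and they account for
  \<open>T ^ T\<close>. Each of the others is at least \<open>T\<close>, and their product divides
  \<open>n\<close>. With \<open>T\<close> free, \<open>2 ^ card (prime_factors n)\<close> is bounded
  by any small power of \<open>n\<close> up to a constant.\<close>

lemma power_card_prime_factors_le:
  fixes n T :: nat
  assumes n: "n > 0" and T: "T > 0"
  shows "T ^ card (prime_factors n) \<le> T ^ T * n"
proof -
  define P where "P = prime_factors n"
  define A where "A = {q \<in> P. q < T}"
  have finP: "finite P" by (simp add: P_def)
  have "card A \<le> card {..<T}" unfolding A_def by (rule card_mono) auto
  then have A: "card A \<le> T" by simp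
  have "card P = card A + card (P - A)"
    using finP by (metis (no_types, lifting) A_def card_Diff_subset card_mono finite_subset le_add_diff_inverse mem_Collect_eq subsetI)
  then have "T ^ card P = T ^ card A * T ^ card (P - A)" by (simp add: power_add)
  also have "T ^ card A \<le> T ^ T" using A T by (intro power_increasing) auto
  also have "T ^ card (P - A) \<le> \<Prod>(P - A)"
  proof -
    have "(\<Prod>q\<in>P - A. T) \<le> (\<Prod>q\<in>P - A. q)" by (rule prod_mono) (auto simp: A_def)
    then show ?thesis by simp
  qed
  also have "\<Prod>(P - A) dvd n"
    using finP by (subst prod_primes_dvd_iff) (auto simp: P_def)
  then have "\<Prod>(P - A) \<le> n" using n by (rule dvd_imp_le)
  finally show ?thesis by (simp add: P_def mult_le_mono)
qed

section \<open>Primitive roots as residues of index coprime to \<open>p - 1\<close>\<close>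

context discrete_log
begin

text \<open>An inverse \<open>w\<close> of the index modulo \<open>p - 1\<close> writes any unit
  \<open>y\<close> as the power of \<open>x\<close> with exponent \<open>w * ind y\<close>. The
  value \<open>x = 1\<close> is excluded because its index is divisible by
  \<open>p - 1 > 1\<close>.\<close>

lemma generates_if_coprime_ind:
  assumes p3: "p > 2" and x: "1 \<le> x" "x < int p" and cop: "coprime (ind x) (p - 1)"
  shows "x > 1" and "generates_Fp_units p x"
proof -
  have nd: "\<not> int p dvd x" using x zdvd_not_zless by auto
  show "x > 1"
  proof (rule ccontr)
    assume "\<not> x > 1"
    then have "[int g ^ ind x = int g ^ 0] (mod int p)" using ind[OF nd] x by simp
    then have "p - 1 dvd ind x" by (simp only: power_cong_iff cong_0_iff)
    then have "p - 1 dvd 1" using cop by (metis coprime_common_divisor dvd_refl)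
    then show False using p3 by simp
  qed
  define G where "G = mult_of (residue_ring (int p))"
  interpret residues_prime p "residue_ring (int p)"
    using prime by unfold_locales (simp_all add: residues_prime_def)
  have carrier: "carrier G = {1..<int p}"
    using p_gt_1 by (auto simp: G_def residue_ring_def)
  have mult: "a \<otimes>\<^bsub>G\<^esub> b = (a * b) mod int p" for a b by (simp add: G_def residue_ring_def)
  have one: "\<one>\<^bsub>G\<^esub> = 1" by (simp add: G_def residue_ring_def)
  interpret G: group G
    unfolding G_def by (rule field_mult_group)
  have xG: "x \<in> carrier G" using x by (simp add: carrier)
  have pow: "(x ^ n) mod int p \<in> generate G {x}" for n
  proof (induction n)
    case 0
    then show ?case using generate.one[of G "{x}"] p_gt_1 by (simp add: one)
  next
    case (Suc n)
    have "x \<otimes>\<^bsub>G\<^esub> ((x ^ n) mod int p) \<in> generate G {x}"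
      by (rule generate.eng[OF generate.incl[of x] Suc]) simp
    then show ?case by (simp add: mult mod_mult_right_eq)
  qed
  have "y \<in> generate G {x}" if y: "y \<in> carrier G" for y
  proof -
    have ndy: "\<not> int p dvd y" using y zdvd_not_zless[of y "int p"] by (auto simp: carrier)
    obtain w where "[ind x * w = 1] (mod (p - 1))"
      using cong_solve_coprime_nat[OF cop] by auto
    then have "[ind x * w * ind y = 1 * ind y] (mod (p - 1))" by (rule cong_mult[OF _ cong_refl])
    then have m: "[ind x * (w * ind y) = ind y] (mod (p - 1))" by (simp add: mult.assoc)
    define m where "m = w * ind y"
    have "[x ^ m = (int g ^ ind x) ^ m] (mod int p)" using ind[OF nd] by (intro cong_pow) (rule cong_sym)
    also have "(int g ^ ind x) ^ m = int g ^ (ind x * m)" by (simp only: power_mult)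
    also have "[\<dots> = int g ^ ind y] (mod int p)" using m by (simp only: power_cong_iff m_def)
    also have "[int g ^ ind y = y] (mod int p)" by (rule ind[OF ndy])
    finally have "(x ^ m) mod int p = y" using y by (simp add: cong_def carrier)
    then show ?thesis using pow[of m] by simp
  qed
  moreover have "generate G {x} \<subseteq> carrier G" using G.generate_incl xG by blast
  ultimately have "generate G {x} = carrier G" by blast
  moreover have "x mod int p = x" using x by simp
  ultimately show "generates_Fp_units p x" by (simp add: generates_Fp_units_def G_def)
qed

end

section \<open>The sieve fed by the character sum bound\<close>

context discrete_log
begin

text \<open>For every divisor \<open>k\<close> of \<open>p - 1\<close>, the triples whose index is
  divisible by \<open>k\<close> are equidistributed up to an error \<open>\<Delta>\<close> given by
  the character sums of order dividing \<open>k\<close>. Inclusion-exclusion over the primes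
  dividing \<open>p - 1\<close> then leaves a triple.\<close>

lemma exists_coprime_ind:
  assumes p: "p \<ge> 100" and Y: "Y \<subseteq> {0..<int p}" and V: "V \<subseteq> {0..<int p}"
    and U: "finite U" "\<And>u. u \<in> U \<Longrightarrow> \<not> int p dvd u"
    and E: "mult_energy p Y U \<le> 7 * (card Y * card U)"
    and Y2: "card Y \<ge> 2" and V2: "real (card V) ^ 2 \<ge> sqrt (real p)"
    and large: "1456 * 2 ^ (8 * card (prime_factors (p - 1))) * sqrt (real p) < real (card Y) * real (card U)"
  shows "\<exists>y\<in>Y. \<exists>u\<in>U. \<exists>v\<in>V. \<not> int p dvd y + u * v \<and> coprime (ind (y + u * v)) (p - 1)"
proof -
  define P where "P = prime_factors (p - 1)"
  define w where "w = card P"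
  define A where "A = Y \<times> U \<times> V"
  define e where "e = (\<lambda>(y, u, v). y + u * v :: int)"
  define X where "X = {x \<in> A. \<not> int p dvd e x}"
  define n where "n = (\<lambda>x. ind (e x))"
  define YU where "YU = real (card Y) * real (card U)"
  define M where "M = YU * real (card V)"
  \<comment> \<open>Here \<open>91 = 7 * 13\<close>: the energy gives 7, and the fourth moment gives
    \<open>13 = 3 + 10\<close> once \<open>card V ^ 2 \<ge> sqrt p\<close>.\<close>
  define \<rho> where "\<rho> = 91 * sqrt (real p) / YU"
  define \<Delta> where "\<Delta> = M * root 4 \<rho>"
  have fin: "finite Y" "finite V" "finite A" "finite X"
    using Y V U finite_subset[of Y] finite_subset[of V] by (auto simp: A_def X_def)
  have s0: "sqrt (real p) > 0" using p by simp
  have "0 \<le> 1456 * 2 ^ (8 * card (prime_factors (p - 1))) * sqrt (real p)" by simp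
  then have YU0: "YU > 0" using large unfolding YU_def by linarith
  have V0: "real (card V) > 0" using V2 s0 by (cases "card V = 0") auto
  have M0: "M > 0" using YU0 V0 by (simp add: M_def)
  have \<rho>0: "\<rho> \<ge> 0" using YU0 s0 by (simp add: \<rho>_def)
  have \<Delta>0: "\<Delta> \<ge> 0" using M0 \<rho>0 by (simp add: \<Delta>_def)
  have \<Delta>4: "\<Delta> ^ 4 = 91 * sqrt (real p) * YU ^ 3 * real (card V) ^ 4"
  proof -
    have "\<Delta> ^ 4 = (YU * real (card V)) ^ 4 * \<rho>" using \<rho>0 by (simp add: \<Delta>_def M_def power_mult_distrib)
    also have "\<dots> = YU ^ 3 * real (card V) ^ 4 * (YU * \<rho>)"
      by (simp add: power_mult_distrib power3_eq_cube power4_eq_xxxx)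
    also have "YU * \<rho> = 91 * sqrt (real p)" using YU0 by (simp add: \<rho>_def)
    finally show ?thesis by simp
  qed
  have cardA: "real (card A) = M" by (simp add: A_def M_def YU_def card_cartesian_product)
  \<comment> \<open>For given \<open>u\<close> and \<open>v\<close> at most one \<open>y\<close>
    makes the sum divisible by \<open>p\<close>, so with \<open>card Y \<ge> 2\<close> at most half
    of the triples are lost.\<close>
  have Xhalf: "real (card X) \<ge> M / 2"
  proof -
    have "card (A - X) \<le> card (U \<times> V)"
    proof (rule card_inj_on_le[where f = snd])
      show "inj_on snd (A - X)"
      proof (rule inj_onI, clarsimp simp: A_def X_def e_def)
        fix y y' u v assume y: "y \<in> Y" "y' \<in> Y" "int p dvd y + u * v" "int p dvd y' + u * v"
        then have "int p dvd (y + u * v) - (y' + u * v)" by (intro dvd_diff)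
        then have "y mod int p = y' mod int p" by (simp add: mod_eq_dvd_iff)
        then show "y = y'" using y Y by (auto simp: subset_iff)
      qed
    qed (use U fin in \<open>auto simp: A_def\<close>)
    then have "2 * card (A - X) \<le> card Y * card (U \<times> V)" using Y2 by (intro mult_le_mono) auto
    also have "\<dots> = card A" by (simp add: A_def card_cartesian_product)
    finally have "2 * card (A - X) \<le> card A" .
    moreover have "card A = card X + card (A - X)"
      using fin by (metis (no_types, lifting) X_def card_Diff_subset card_mono finite_subset le_add_diff_inverse mem_Collect_eq subsetI)
    ultimately show ?thesis using cardA by linarith
  qed
  have main: "\<bar>real (card {x \<in> X. k dvd n x}) - real (card X) / real k\<bar> \<le> \<Delta>" if kd: "k dvd p - 1" for k
  proof (cases "k = 1")
    case True
    then show ?thesis using \<Delta>0 by simp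
  next
    case False
    then have k: "k \<ge> 2" using kd p by (cases k) (auto simp: Suc_le_eq)
    obtain m where km: "k * m = p - 1" using kd by (metis dvd_def)
    define T where "T = (\<lambda>j. \<Sum>(y, u)\<in>Y \<times> U. \<Sum>v\<in>V. char k j (y + u * v))"
    have T: "T j = (\<Sum>x\<in>A. char k j (e x))" for j
      unfolding T_def sum.cartesian_product[symmetric]
      by (simp add: A_def e_def sum.cartesian_product case_prod_unfold)
    define S where "S = (\<Sum>j\<in>{1..<k}. cmod (T j))"
    have "S ^ 4 \<le> real k ^ 4 * YU ^ 2 * real (mult_energy p Y U) *
       (3 * real p * real (card V) ^ 2 + 10 * sqrt (real p) * real (card V) ^ 4)"
      unfolding S_def T_def YU_def by (rule char_sum_bound[OF p km k V fin(1) U])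
    also have "\<dots> \<le> real k ^ 4 * YU ^ 2 * (7 * YU) * (13 * sqrt (real p) * real (card V) ^ 4)"
    proof (intro mult_mono order.refl)
      show "real (mult_energy p Y U) \<le> 7 * YU"
        using E unfolding YU_def by (metis of_nat_le_iff of_nat_mult of_nat_numeral)
      have "real p * real (card V) ^ 2 = sqrt (real p) * real (card V) ^ 2 * sqrt (real p)" by simp
      also have "\<dots> \<le> sqrt (real p) * real (card V) ^ 2 * real (card V) ^ 2"
        using V2 s0 by (intro mult_left_mono) auto
      also have "\<dots> = sqrt (real p) * real (card V) ^ 4" by (simp add: mult.assoc flip: power_add)
      finally show "3 * real p * real (card V) ^ 2 + 10 * sqrt (real p) * real (card V) ^ 4
         \<le> 13 * sqrt (real p) * real (card V) ^ 4" by linarith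
    qed (use YU0 in auto)
    also have "\<dots> = (real k * \<Delta>) ^ 4"
      by (simp add: power_mult_distrib \<Delta>4 power2_eq_square power3_eq_cube)
    finally have "S \<le> real k * \<Delta>"
      using \<Delta>0 by (intro power_le_imp_le_base[of S 3 "real k * \<Delta>"]) (auto simp: numeral_eq_Suc)
    \<comment> \<open>Orthogonality over all \<open>j < k\<close> gives the first count and the
      principal character gives \<open>card X\<close>, so the difference is the sum over the other
      characters.\<close>
    moreover have "cmod (of_nat (k * card {x \<in> X. k dvd n x}) - of_nat (card X)) \<le> S"
    proof -
      have "(\<Sum>j<k. T j) = (\<Sum>x\<in>A. \<Sum>j<k. char k j (e x))" unfolding T by (rule sum.swap)
      also have "\<dots> = (\<Sum>x\<in>A. if \<not> int p dvd e x \<and> k dvd ind (e x) then of_nat k else 0)"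
        using k by (intro sum.cong sum_char) auto
      also have "\<dots> = (\<Sum>x\<in>{x \<in> X. k dvd n x}. of_nat k)"
        by (rule sum.mono_neutral_cong_right) (use fin in \<open>auto simp: X_def n_def\<close>)
      also have "\<dots> = of_nat (k * card {x \<in> X. k dvd n x})" by simp
      finally have "of_nat (k * card {x \<in> X. k dvd n x}) = (\<Sum>j<k. T j)" by simp
      also have "{..<k} = insert 0 {1..<k}" using k by auto
      also have "sum T (insert 0 {1..<k}) = T 0 + sum T {1..<k}" by simp
      also have "T 0 = (\<Sum>x\<in>X. 1)"
        unfolding T by (rule sum.mono_neutral_cong_right) (use fin in \<open>auto simp: X_def char_def\<close>)
      finally have "of_nat (k * card {x \<in> X. k dvd n x}) - of_nat (card X) = sum T {1..<k}" by simp
      then show ?thesis unfolding S_def by (simp only: norm_sum)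
    qed
    moreover have "cmod (of_nat (k * card {x \<in> X. k dvd n x}) - of_nat (card X)) =
        \<bar>real k * real (card {x \<in> X. k dvd n x}) - real (card X)\<bar>"
    proof -
      have "of_nat (k * card {x \<in> X. k dvd n x}) - of_nat (card X) =
          complex_of_real (real k * real (card {x \<in> X. k dvd n x}) - real (card X))" by simp
      then show ?thesis by (simp only: norm_of_real)
    qed
    ultimately have "\<bar>real k * real (card {x \<in> X. k dvd n x}) - real (card X)\<bar> \<le> real k * \<Delta>"
      by (metis order.trans)
    moreover have "real k * real (card {x \<in> X. k dvd n x}) - real (card X) =
        real k * (real (card {x \<in> X. k dvd n x}) - real (card X) / real k)" using k by (simp add: field_simps)
    ultimately have "real k * \<bar>real (card {x \<in> X. k dvd n x}) - real (card X) / real k\<bar> \<le> real k * \<Delta>"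
      by (simp add: abs_mult)
    then show ?thesis using k by simp
  qed
  have P: "finite P" "\<And>q. q \<in> P \<Longrightarrow> prime q" by (auto simp: P_def)
  have "real (card {x \<in> X. \<forall>q\<in>P. \<not> q dvd n x}) \<ge> real (card X) / 2 ^ w - 2 ^ w * \<Delta>"
    unfolding w_def
  proof (rule inclusion_exclusion_primes[OF fin(4) P])
    fix S assume S: "S \<subseteq> P"
    then have "\<Prod>S dvd p - 1"
      using P finite_subset[OF S] by (subst prod_primes_dvd_iff) (auto simp: P_def)
    then show "\<bar>real (card {x \<in> X. \<Prod>S dvd n x}) - real (card X) / real (\<Prod>S)\<bar> \<le> \<Delta>" by (rule main)
  qed
  moreover have "real (card X) / 2 ^ w - 2 ^ w * \<Delta> > 0"
  proof -
    \<comment> \<open>By \<open>Xhalf\<close>, positivity follows if this quantity is below 1; its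
      size is controlled by \<open>large\<close>, as \<open>1456 = 16 * 91\<close>.\<close>
    have "(2 * 4 ^ w * root 4 \<rho>) ^ 4 = 16 * (4 ^ w) ^ 4 * \<rho>" using \<rho>0 by (simp add: power_mult_distrib)
    also have "(4 ^ w) ^ 4 = (2 :: real) ^ (8 * w)"
    proof -
      have "(4 :: real) ^ w = 2 ^ (2 * w)" by (simp add: power_mult)
      then show ?thesis by (simp add: power_mult[symmetric] mult.commute)
    qed
    also have "16 * 2 ^ (8 * w) * \<rho> = (1456 * 2 ^ (8 * w) * sqrt (real p)) / YU" by (simp add: \<rho>_def)
    also have "\<dots> < 1" using large YU0 by (simp add: YU_def P_def w_def)
    finally have "2 * 4 ^ w * root 4 \<rho> < 1" by (metis power_less_imp_less_base power_one zero_le_one)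
    then have "M * (2 * 4 ^ w * root 4 \<rho>) < M * 1" using M0 by (intro mult_strict_left_mono)
    then have "4 ^ w * \<Delta> < M / 2" by (simp add: \<Delta>_def mult_ac)
    also note Xhalf
    also have "4 ^ w * \<Delta> = 2 ^ w * (2 ^ w * \<Delta>)" by (simp add: power_mult_distrib[symmetric] flip: mult.assoc)
    finally show ?thesis by (simp add: field_simps)
  qed
  ultimately have "card {x \<in> X. \<forall>q\<in>P. \<not> q dvd n x} \<noteq> 0" by linarith
  then have "{x \<in> X. \<forall>q\<in>P. \<not> q dvd n x} \<noteq> {}" by (metis card.empty)
  then obtain x where x: "x \<in> X" "\<forall>q\<in>P. \<not> q dvd n x" by blast
  have "coprime (n x) (p - 1)"
  proof (rule ccontr)
    assume "\<not> coprime (n x) (p - 1)"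
    then have "gcd (n x) (p - 1) \<noteq> 1" using coprime_iff_gcd_eq_1 by blast
    then obtain q where "prime q" "q dvd gcd (n x) (p - 1)" using prime_factor_nat by blast
    then have "prime q" "q dvd n x" "q dvd p - 1" by simp_all
    then have "q \<in> P" using p by (auto simp: P_def prime_factors_dvd)
    then show False using x \<open>q dvd n x\<close> by blast
  qed
  moreover obtain y u v where "x = (y, u, v)" by (cases x)
  ultimately show ?thesis using x(1) by (auto simp: X_def A_def n_def e_def)
qed

end

text \<open>With \<open>t = p powr (1 / (2 * d))\<close>, the Bohr set of radius near
  \<open>p / t\<close> has about \<open>t ^ d = sqrt p\<close> elements. The factor \<open>H\<close>
  gained from \<open>U\<close> beats the sieve loss, while \<open>V\<close> lives in a radius so
  small that \<open>u * v\<close> moves \<open>y\<close> by at most \<open>R\<close> in every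
  coordinate.\<close>

lemma exists_primitive_root_in_bohr:
  fixes d H :: nat and t :: real
  assumes p: "prime p" and \<Gamma>: "finite \<Gamma>" "card \<Gamma> = d" "r1 \<in> \<Gamma>" "\<not> int p dvd r1"
    and t: "t ^ (2 * d) = real p" and H: "H \<ge> 100" "real H ^ 8 \<le> t"
    and large: "1456 * 2 ^ d * 2 ^ (8 * card (prime_factors (p - 1))) < real H"
  shows "\<exists>x. 1 < x \<and> x < int p \<and> generates_Fp_units p x \<and> (\<exists>R. real_of_int R \<le> 4 * real p / t \<and> x \<in> bohr p \<Gamma> R)"
proof -
  have d: "d \<ge> 1" using \<Gamma> by (cases d) auto
  obtain g where g: "residue_primroot p g"
    using residue_prime_has_primroot[OF p] p
    by (auto simp: residue_primroot_def totient_prime totatives_def prime_gt_0_nat coprime_commute)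
  interpret discrete_log p g by unfold_locales (fact p, fact g)
  define h where "h = real H"
  have h: "h \<ge> 100" using H by (simp add: h_def)
  have hpow: "h ^ a \<le> h ^ b" if "a \<le> b" for a b using h that by (intro power_increasing) auto
  have th: "h ^ 8 \<le> t" using H by (simp add: h_def)
  have h2: "h ^ 2 \<ge> 10000" using power_mono[OF h, of 2] by simp
  have t100: "t \<ge> 10000" using th hpow[of 2 8] h2 by linarith
  have tp: "t ^ 2 \<le> real p" unfolding t[symmetric] using t100 d by (intro power_increasing) auto
  have "t * 1 \<le> t * t" using t100 by (intro mult_left_mono) auto
  then have tlep: "t \<le> real p" using tp by (simp add: power2_eq_square)
  have "real p \<ge> 100" using tlep t100 by simp
  then have p100: "p \<ge> 100" by linarith
  have td: "t ^ d = sqrt (real p)"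
    using t t100 by (intro real_sqrt_unique[symmetric]) (simp_all add: power_mult[symmetric] mult.commute)
  define R where "R = \<lceil>real p / t\<rceil>"
  define R2 where "R2 = R div (2 * int H ^ 2)"
  have pt: "real p / t \<ge> t" using tp t100 by (simp add: field_simps power2_eq_square)
  have Rge: "real_of_int R \<ge> real p / t" by (simp add: R_def)
  have Rle: "real_of_int R \<le> 2 * (real p / t)" using pt t100 unfolding R_def by linarith
  have R0: "R \<ge> 0" using Rge pt t100 by linarith
  have R20: "R2 \<ge> 0" using R0 H by (simp add: R2_def pos_imp_zdiv_nonneg_iff)
  \<comment> \<open>This prevents wrap-around in the energy bound; it holds because
    \<open>8 * h ^ 2 < h ^ 4 \<le> t\<close>.\<close>
  have HHp: "2 * (h ^ 2 + h) * real_of_int R < real p"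
  proof -
    have "h ^ 2 + h \<le> 2 * h ^ 2" using hpow[of 1 2] by simp
    then have "2 * (h ^ 2 + h) * real_of_int R \<le> 2 * (2 * h ^ 2) * (2 * (real p / t))"
      using Rle R0 h by (intro mult_mono) auto
    also have "\<dots> = (8 * h ^ 2 / t) * real p" by simp
    also have "\<dots> < 1 * real p"
    proof (rule mult_strict_right_mono)
      have "8 * h ^ 2 < h ^ 2 * h ^ 2" using h2 h by (intro mult_strict_right_mono) auto
      also have "\<dots> \<le> t" using th hpow[of 4 8] by (simp flip: power_add)
      finally show "8 * h ^ 2 / t < 1" using t100 by simp
    qed (use p100 in simp)
    finally show ?thesis by simp
  qed
  define Y where "Y = bohr p \<Gamma> R"
  define V where "V = bohr p \<Gamma> R2"
  define U where "U = {int (H ^ 2) + 1..int (H ^ 2 + H)}"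
  have cardU: "card U = H" by (simp add: U_def)
  have HHR: "2 * int (H ^ 2 + H) * R < int p"
  proof -
    have "real_of_int (2 * int (H ^ 2 + H) * R) < real_of_int (int p)" using HHp by (simp add: h_def)
    then show ?thesis by (simp only: of_int_less_iff)
  qed
  have "1 * real_of_int R \<le> 2 * (h ^ 2 + h) * real_of_int R" using h h2 R0 by (intro mult_right_mono) auto
  then have Rp: "R < int p" using HHp by linarith
  have "h ^ 2 + h < real p"
  proof -
    have "h ^ 2 + h \<le> 2 * h ^ 2" using hpow[of 1 2] by simp
    also have "\<dots> < h ^ 2 * h ^ 2" using h2 h by (intro mult_strict_right_mono) auto
    also have "\<dots> \<le> t" using th hpow[of 4 8] by (simp flip: power_add)
    finally show ?thesis using tlep by simp
  qed
  then have Hp: "H ^ 2 + H < p" unfolding h_def by (metis of_nat_add of_nat_less_iff of_nat_power)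
  have div_le: "real_of_int (int p div (S + 1)) \<le> real p / s" if "s > 0" "s \<le> real_of_int S + 1" for S s
  proof -
    have "real_of_int (int p div (S + 1)) \<le> real p / (real_of_int S + 1)"
      using real_of_int_div4[of "int p" "S + 1"] by simp
    also have "\<dots> \<le> real p / s" using that by (intro divide_left_mono) auto
    finally show ?thesis .
  qed
  have bohr_ge: "real p \<le> (a + 1) ^ d * real (card (bohr p \<Gamma> S))"
    if "S \<ge> 0" "real_of_int (int p div (S + 1)) \<le> a" for S a
  proof -
    have "real_of_int (int p) \<le> real_of_int ((int p div (S + 1) + 1) ^ card \<Gamma> * int (card (bohr p \<Gamma> S)))"
      using card_bohr_ge[of p S \<Gamma>] p100 that \<Gamma> by (simp only: of_int_le_iff)
    also have "\<dots> = (real_of_int (int p div (S + 1)) + 1) ^ d * real (card (bohr p \<Gamma> S))" using \<Gamma> by simp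
    also have "\<dots> \<le> (a + 1) ^ d * real (card (bohr p \<Gamma> S))"
      using that p100 by (intro mult_right_mono power_mono add_right_mono) (auto simp: pos_imp_zdiv_nonneg_iff)
    finally show ?thesis by simp
  qed
  have pt0: "real p / t > 0" using pt t100 by linarith
  \<comment> \<open>There are at most \<open>t + 1 \<le> 2 * t\<close> boxes in each direction for
    \<open>p = t ^ (2 * d)\<close> residues.\<close>
  have Yge: "(t / 2) ^ d \<le> real (card Y)"
  proof -
    have "real_of_int (int p div (R + 1)) \<le> real p / (real p / t)" using Rge pt0 by (intro div_le) auto
    then have "real_of_int (int p div (R + 1)) \<le> t" using p100 by simp
    from bohr_ge[OF R0 this] have "t ^ d * t ^ d \<le> (t + 1) ^ d * real (card Y)"
      by (simp add: Y_def t[symmetric] power_add[symmetric] mult_2)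
    also have "\<dots> \<le> (2 * t) ^ d * real (card Y)" using t100 by (intro mult_right_mono power_mono) auto
    also have "\<dots> = t ^ d * (2 ^ d * real (card Y))" by (simp add: power_mult_distrib)
    finally have "t ^ d \<le> 2 ^ d * real (card Y)" using t100 by simp
    then show ?thesis by (simp add: power_divide field_simps)
  qed
  have "t / 2 \<le> (t / 2) ^ d" using t100 d power_increasing[of 1 d "t / 2"] by simp
  then have Yt: "t / 2 \<le> real (card Y)" using Yge by linarith
  have "h * 2 \<le> h * h" using h by (intro mult_left_mono) auto
  also have "\<dots> \<le> t" using th hpow[of 2 8] by (simp add: power2_eq_square)
  finally have HY: "H \<le> card Y" using Yt by (simp add: h_def)
  \<comment> \<open>Shrinking the radius by \<open>b = 2 * H ^ 2\<close> costs a factor of about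
    \<open>b ^ d\<close>. The result \<open>(t / (2 * b)) ^ d\<close> still suffices because
    \<open>(2 * b) ^ 2 = 16 * H ^ 4 \<le> H ^ 6 \<le> t\<close>.\<close>
  have V2: "real (card V) ^ 2 \<ge> sqrt (real p)"
  proof -
    define b where "b = 2 * h ^ 2"
    have b1: "b \<ge> 1" using h2 by (simp add: b_def)
    have "R < 2 * int H ^ 2 * (R2 + 1)"
    proof -
      have "R = 2 * int H ^ 2 * R2 + R mod (2 * int H ^ 2)" by (simp add: R2_def)
      moreover have "R mod (2 * int H ^ 2) < 2 * int H ^ 2" using H by (intro pos_mod_bound) auto
      ultimately show ?thesis by (simp add: algebra_simps)
    qed
    then have "real_of_int R < real_of_int (2 * int H ^ 2 * (R2 + 1))" by (simp only: of_int_less_iff)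
    then have "real p / t \<le> b * (real_of_int R2 + 1)" using Rge by (simp add: b_def h_def)
    then have "real p / t / b \<le> real_of_int R2 + 1"
      using b1 by (subst pos_divide_le_eq) (simp_all add: mult.commute)
    moreover have "0 < real p / t / b" using p100 t100 b1 by (intro divide_pos_pos) auto
    ultimately have "real_of_int (int p div (R2 + 1)) \<le> real p / (real p / t / b)"
      by (intro div_le)
    also have "\<dots> = b * t" using p100 by simp
    finally have "real_of_int (int p div (R2 + 1)) \<le> b * t" .
    from bohr_ge[OF R20 this] have "t ^ d * t ^ d \<le> (b * t + 1) ^ d * real (card V)"
      by (simp add: V_def t[symmetric] power_add[symmetric] mult_2)
    also have "\<dots> \<le> (2 * b * t) ^ d * real (card V)"
    proof (intro mult_right_mono power_mono)
      have "1 * 1 \<le> b * t" using b1 t100 by (intro mult_mono) auto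
      then show "b * t + 1 \<le> 2 * b * t" by simp
    qed (use b1 t100 in auto)
    also have "\<dots> = t ^ d * ((2 * b) ^ d * real (card V))" by (simp add: power_mult_distrib)
    finally have "t ^ d \<le> (2 * b) ^ d * real (card V)" using t100 by simp
    then have "(t ^ d) ^ 2 \<le> ((2 * b) ^ d * real (card V)) ^ 2"
      using t100 by (intro power_mono) auto
    also have "((2 * b) ^ d * real (card V)) ^ 2 = ((2 * b) ^ 2) ^ d * real (card V) ^ 2"
      by (simp only: power_mult_distrib[of _ "real (card V)"] power_mult[symmetric] mult.commute[of d 2])
    finally have "t ^ d * t ^ d \<le> ((2 * b) ^ 2) ^ d * real (card V) ^ 2" by (simp only: power2_eq_square)
    also have "\<dots> \<le> t ^ d * real (card V) ^ 2"
    proof (intro mult_right_mono power_mono)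
      have "(2 * b) ^ 2 = 16 * h ^ 4" by (simp add: b_def power_mult_distrib)
      also have "\<dots> \<le> h ^ 2 * h ^ 4" using h2 by (intro mult_right_mono) auto
      also have "\<dots> \<le> t" using th hpow[of 6 8] by (simp flip: power_add)
      finally show "(2 * b) ^ 2 \<le> t" .
    qed auto
    finally have "t ^ d \<le> real (card V) ^ 2" using t100 by (subst (asm) mult_le_cancel_left_pos) auto
    then show ?thesis by (simp only: td)
  qed
  have ndU: "\<not> int p dvd u" if "u \<in> U" for u
  proof -
    have "int (H ^ 2) + 1 \<le> u" "u \<le> int (H ^ 2 + H)" using that by (simp_all only: U_def atLeastAtMost_iff)
    moreover have "int (H ^ 2 + H) < int p" using Hp by (simp only: of_nat_less_iff)
    ultimately have "0 < u" "u < int p" by linarith+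
    then show ?thesis using zdvd_not_zless by auto
  qed
  have "\<exists>y\<in>Y. \<exists>u\<in>U. \<exists>v\<in>V. \<not> int p dvd y + u * v \<and> coprime (ind (y + u * v)) (p - 1)"
  proof (rule exists_coprime_ind[OF p100 _ _ _ ndU _ _ V2])
    show "mult_energy p Y U \<le> 7 * (card Y * card U)"
      unfolding cardU unfolding Y_def using H HY Y_def
      by (intro mult_energy_bohr_le[OF p \<Gamma>(1,3,4) _ R0 HHR Rp Hp _ U_def]) auto
    show "2 \<le> card Y" using HY H by simp
    have "1456 * 2 ^ (8 * card (prime_factors (p - 1))) * sqrt (real p) =
       (1456 * 2 ^ d * 2 ^ (8 * card (prime_factors (p - 1)))) * (t / 2) ^ d"
      by (simp add: td[symmetric] power_divide)
    also have "\<dots> < real H * (t / 2) ^ d" using large t100 by (intro mult_strict_right_mono) auto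
    also have "\<dots> \<le> real H * real (card Y)" using Yge by (intro mult_left_mono) auto
    finally show "1456 * 2 ^ (8 * card (prime_factors (p - 1))) * sqrt (real p) < real (card Y) * real (card U)"
      by (simp add: cardU mult.commute)
  qed (auto simp: Y_def V_def U_def bohr_subset simp del: of_nat_add of_nat_power)
  then obtain y u v where yuv: "y \<in> Y" "u \<in> U" "v \<in> V" "\<not> int p dvd y + u * v"
      "coprime (ind (y + u * v)) (p - 1)" by blast
  define x where "x = (y + u * v) mod int p"
  have xc: "[x = y + u * v] (mod int p)" by (simp add: x_def)
  have "x \<noteq> 0" using yuv(4) by (auto simp: x_def dvd_eq_mod_eq_0)
  moreover have "0 \<le> x" "x < int p" using p100 by (simp_all add: x_def)
  ultimately have x: "1 \<le> x" "x < int p" by auto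
  have cop: "coprime (ind x) (p - 1)" using yuv(5) ind_cong[OF xc] by simp
  \<comment> \<open>As \<open>u \<le> H ^ 2 + H \<le> 2 * H ^ 2\<close>, the divisor in
    \<open>R2\<close> was chosen for this; the doubled radius together with \<open>Rle\<close>
    yields the constant 4.\<close>
  have "R + \<bar>u\<bar> * R2 \<le> 2 * R"
  proof -
    have "\<bar>u\<bar> \<le> 2 * int H ^ 2"
    proof -
      have "int H ^ 2 + 1 \<le> u" "u \<le> int H ^ 2 + int H" using yuv(2) by (simp_all add: U_def)
      moreover have "int H \<le> int H ^ 2" using H by (simp add: power2_eq_square)
      moreover have "0 \<le> int H ^ 2" by simp
      ultimately show ?thesis by linarith
    qed
    then have "\<bar>u\<bar> * R2 \<le> 2 * int H ^ 2 * R2" using R20 by (intro mult_right_mono)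
    also have "\<dots> \<le> R" unfolding R2_def using H by (simp add: minus_mod_eq_mult_div[symmetric])
    finally show ?thesis by simp
  qed
  then have "x \<in> bohr p \<Gamma> (2 * R)"
    unfolding x_def using yuv p100 by (intro bohr_add_mult[of y p \<Gamma> R v R2]) (auto simp: Y_def V_def)
  moreover have "real_of_int (2 * R) \<le> 4 * real p / t" using Rle by simp
  moreover have "1 < x" "generates_Fp_units p x"
    using generates_if_coprime_ind[OF _ x cop] p100 by auto
  ultimately show ?thesis using x by blast
qed

section \<open>Absorbing the sieve loss, and the final assembly\<close>

lemma mult_power_card_prime_factors_less:
  fixes d H p :: nat
  defines "w \<equiv> card (prime_factors (p - 1))" and "K \<equiv> (2 ^ (256 * d)) ^ (2 ^ (256 * d)) :: nat"
  assumes d: "d \<ge> 1" and p: "p > 1" and H: "p \<le> (H + 1) ^ (16 * d)" and large: "H > 2 * K * c ^ 2"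
  shows "c * 2 ^ (8 * w) < H"
proof -
  have K: "K \<ge> 1" by (simp add: K_def)
  \<comment> \<open>The prime factor bound is applied with \<open>T = 2 ^ (256 * d)\<close>, so that
    a root of order \<open>16 * d\<close> can be taken against
    \<open>p \<le> (H + 1) ^ (16 * d)\<close>.\<close>
  have "(2 ^ (16 * w)) ^ (16 * d) = (2 ^ (256 * d) :: nat) ^ w"
    by (simp add: power_mult[symmetric] mult_ac)
  also have "\<dots> \<le> K * (p - 1)"
    unfolding w_def K_def using p by (intro power_card_prime_factors_le) auto
  also have "\<dots> \<le> K ^ (16 * d) * (H + 1) ^ (16 * d)"
    using H K d by (intro mult_le_mono self_le_power) auto
  also have "\<dots> = (K * (H + 1)) ^ (16 * d)" by (simp only: power_mult_distrib)
  finally have "2 ^ (16 * w) \<le> K * (H + 1)" using d by (subst (asm) power_mono_iff) auto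
  also have "\<dots> \<le> K * (2 * H)" using large by (intro mult_le_mono) auto
  \<comment> \<open>The left side is the square of the quantity to be bounded, and the right side is
    only linear in \<open>H\<close>.\<close>
  finally have "c ^ 2 * 2 ^ (16 * w) \<le> c ^ 2 * (K * (2 * H))" by (rule mult_le_mono2)
  also have "\<dots> = (2 * K * c ^ 2) * H" by (simp add: mult_ac)
  also have "\<dots> < H * H" using large by (intro mult_strict_right_mono) auto
  also have "c ^ 2 * 2 ^ (16 * w) = (c * 2 ^ (8 * w)) ^ 2"
    by (simp add: power_mult_distrib power_mult[symmetric] mult.commute)
  finally have "(c * 2 ^ (8 * w)) ^ 2 < H ^ 2" by (simp only: power2_eq_square[of H])
  then show ?thesis by (rule power_less_imp_less_base) simp
qed

lemma dist_int_le_of_bohr: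
  assumes p: "p > 0" and x: "x \<in> bohr p \<Gamma> R" and r: "r \<in> \<Gamma>"
  shows "dist_int (real_of_int x * (real_of_int r / real p)) \<le> real_of_int R / real p"
proof -
  obtain s where s: "\<bar>s\<bar> \<le> R" "[x * r = s] (mod int p)" using x r by (rule bohrE)
  then obtain q where "x * r - s = int p * q" by (auto simp: cong_iff_dvd_diff)
  then have "real_of_int (x * r) = real_of_int (s + int p * q)" by (simp only: diff_eq_eq add.commute)
  then have "real_of_int x * (real_of_int r / real p) - real_of_int q = real_of_int s / real p"
    using p by (simp add: field_simps)
  then have "dist (real_of_int x * (real_of_int r / real p)) (real_of_int q) = real_of_int \<bar>s\<bar> / real p"
    by (simp add: dist_real_def)
  moreover have "real_of_int \<bar>s\<bar> / real p \<le> real_of_int R / real p"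
    using s(1) by (intro divide_right_mono) (simp_all only: of_int_le_iff of_nat_0_le_iff)
  moreover have "dist_int (real_of_int x * (real_of_int r / real p)) \<le>
      dist (real_of_int x * (real_of_int r / real p)) (real_of_int q)"
    by (rule infdist_le) simp
  ultimately show ?thesis by linarith
qed

text \<open>The distances are at most \<open>4 / t\<close> with
  \<open>t = p powr (1 / (2 * d))\<close>. Since \<open>totient (p - 1) \<le> p\<close>, the
  quotient \<open>t / totient (p - 1) powr (1 / d)\<close> is at least \<open>1 / t\<close>, so the
  constant 4 serves.\<close>

theorem theorem2p4:
  fixes d :: nat
  assumes "d \<ge> 1"
  shows "\<exists>C::real. C > 0 \<and> (\<exists>p0::nat. \<forall>p::nat. prime p \<and> p \<ge> p0 \<longrightarrow>
    (\<forall>\<Gamma>::int set. finite \<Gamma> \<and> card \<Gamma> = d \<longrightarrow>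
      (\<exists>x::int. 1 < x \<and> x < int p \<and> generates_Fp_units p x \<and>
        Max ((\<lambda>r. dist_int (real_of_int x * (real_of_int r / real p))) ` \<Gamma>)
          \<le> C * (real p powr (1 / (2 * real d)) * ln (real p)
                 / real (totient (p - 1)) powr (1 / real d)))))"
proof -
  define K :: nat where "K = (2 ^ (256 * d)) ^ (2 ^ (256 * d))"
  define c :: nat where "c = 1456 * 2 ^ d"
  \<comment> \<open>Any \<open>H \<ge> h\<close> meets both requirements
    \<open>H > 2 * K * c ^ 2\<close> and \<open>H \<ge> 100\<close>; the threshold
    \<open>(h ^ 8) ^ (2 * d)\<close> for \<open>p\<close> forces \<open>H \<ge> h\<close>.\<close>
  define h where "h = 2 * K * c ^ 2 + 100"
  have main: "\<exists>x::int. 1 < x \<and> x < int p \<and> generates_Fp_units p x \<and>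
        Max ((\<lambda>r. dist_int (real_of_int x * (real_of_int r / real p))) ` \<Gamma>)
          \<le> 4 * (real p powr (1 / (2 * real d)) * ln (real p)
                 / real (totient (p - 1)) powr (1 / real d))"
    if p: "prime p" "p \<ge> (h ^ 8) ^ (2 * d)" and \<Gamma>: "finite \<Gamma>" "card \<Gamma> = d" for p and \<Gamma> :: "int set"
  proof -
    define t where "t = real p powr (1 / (2 * real d))"
    \<comment> \<open>The largest integer with \<open>H ^ 8 \<le> t\<close>; the matching bound
      \<open>t \<le> (H + 1) ^ 8\<close> gives \<open>p \<le> (H + 1) ^ (16 * d)\<close>.\<close>
    define H where "H = nat \<lfloor>root 8 t\<rfloor>"
    have p1: "p > 1" using p(1) by (rule prime_gt_1_nat)
    have t0: "t > 0" using p1 by (simp add: t_def)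
    have t: "t ^ (2 * d) = real p"
      using p1 assms by (simp add: t_def powr_powr flip: powr_realpow)
    have "real (h ^ 8) ^ (2 * d) \<le> t ^ (2 * d)" using p(2) unfolding t by (metis of_nat_le_iff of_nat_power)
    then have "real h ^ 8 \<le> t" using assms t0 by (subst (asm) power_mono_iff) auto
    then have "root 8 (real h ^ 8) \<le> root 8 t" by simp
    then have hr: "real h \<le> root 8 t" by (simp add: real_root_power_cancel)
    have Hle: "real H \<le> root 8 t" and Hgt: "root 8 t < real H + 1"
      unfolding H_def using t0 by (simp_all add: of_nat_nat)
    have hH: "h \<le> H" unfolding H_def using hr by (simp add: le_nat_floor)
    have r8: "root 8 t ^ 8 = t" using t0 by (intro real_root_pow_pos2) auto
    have H8: "real H ^ 8 \<le> t" using power_mono[OF Hle, of 8] r8 by simp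
    have "t \<le> (real H + 1) ^ 8" using power_mono[OF less_imp_le[OF Hgt], of 8] t0 r8 by simp
    then have "t ^ (2 * d) \<le> ((real H + 1) ^ 8) ^ (2 * d)" using t0 by (intro power_mono) auto
    also have "\<dots> = real ((H + 1) ^ (16 * d))" by (simp add: add.commute flip: power_mult)
    finally have pH: "p \<le> (H + 1) ^ (16 * d)" unfolding t by (simp only: of_nat_le_iff)
    have "c * 2 ^ (8 * card (prime_factors (p - 1))) < H"
      using mult_power_card_prime_factors_less[OF assms p1 pH, of c] hH by (simp add: h_def K_def)
    then have "real (c * 2 ^ (8 * card (prime_factors (p - 1)))) < real H" by (simp only: of_nat_less_iff)
    then have large: "1456 * 2 ^ d * 2 ^ (8 * card (prime_factors (p - 1))) < real H" by (simp add: c_def)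
    have H100: "H \<ge> 100" using hH by (simp add: h_def)
    \<comment> \<open>If \<open>p\<close> divides every element of \<open>\<Gamma>\<close>, all
      distances are zero and any primitive root works. The substitute set then only supplies one,
      and it contains 1, which is a unit modulo \<open>p\<close>.\<close>
    define \<Gamma>' where "\<Gamma>' = (if \<exists>r\<in>\<Gamma>. \<not> int p dvd r then \<Gamma> else {1..int d})"
    have \<Gamma>': "finite \<Gamma>'" "card \<Gamma>' = d" using \<Gamma> by (auto simp: \<Gamma>'_def)
    obtain r1 where r1: "r1 \<in> \<Gamma>'" "\<not> int p dvd r1"
    proof (cases "\<exists>r\<in>\<Gamma>. \<not> int p dvd r")
      case True
      then show ?thesis using that by (auto simp: \<Gamma>'_def)
    next
      case False
      then show ?thesis using that[of 1] assms p1 by (simp add: \<Gamma>'_def)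
    qed
    obtain x R where x: "1 < x" "x < int p" "generates_Fp_units p x"
      and R: "real_of_int R \<le> 4 * real p / t" "x \<in> bohr p \<Gamma>' R"
      using exists_primitive_root_in_bohr[OF p(1) \<Gamma>' r1 t H100 H8 large] by blast
    have "dist_int (real_of_int x * (real_of_int r / real p)) \<le> 4 / t" if r: "r \<in> \<Gamma>" for r
    proof (cases "\<exists>r\<in>\<Gamma>. \<not> int p dvd r")
      case True
      then have "r \<in> \<Gamma>'" using r by (simp add: \<Gamma>'_def)
      then have "dist_int (real_of_int x * (real_of_int r / real p)) \<le> real_of_int R / real p"
        using p1 by (intro dist_int_le_of_bohr[OF _ R(2)]) auto
      also have "\<dots> \<le> (4 * real p / t) / real p" using R(1) by (intro divide_right_mono) auto
      also have "\<dots> = 4 / t" using p1 by simp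
      finally show ?thesis .
    next
      case False
      then obtain q where "r = int p * q" using r by auto
      then have "real_of_int x * (real_of_int r / real p) = real_of_int (x * q)" using p1 by simp
      then have "dist_int (real_of_int x * (real_of_int r / real p)) = 0"
        by (simp only: Ints_of_int infdist_zero)
      then show ?thesis using t0 by simp
    qed
    moreover have "\<Gamma> \<noteq> {}" using \<Gamma> assms by auto
    ultimately have "Max ((\<lambda>r. dist_int (real_of_int x * (real_of_int r / real p))) ` \<Gamma>) \<le> 4 / t"
      using \<Gamma> by (subst Max_le_iff) auto
    also have "4 / t \<le> 4 * (t * ln (real p) / real (totient (p - 1)) powr (1 / real d))"
    proof -
      have p3: "real p \<ge> 3"
      proof -
        have "real H ^ 1 \<le> real H ^ 8" using H100 by (intro power_increasing) auto
        then have "real H \<le> t" using H8 unfolding power_one_right by (rule order.trans)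
        then have "real h \<le> t" using hH by linarith
        moreover have "real h \<ge> 100" by (simp add: h_def)
        ultimately have t100: "t \<ge> 100" by linarith
        moreover have "t \<le> t ^ (2 * d)" using t100 assms by (intro self_le_power) auto
        ultimately show ?thesis unfolding t by linarith
      qed
      \<comment> \<open>The logarithm enters only as a factor at least 1, which follows from
        \<open>p \<ge> 3 \<ge> exp 1\<close>.\<close>
      then have ln1: "ln (real p) \<ge> 1" using exp_le by (subst ln_ge_iff) auto
      have tot: "totient (p - 1) > 0" using p3 by (simp add: totient_gt_0_iff)
      have "real (totient (p - 1)) powr (1 / real d) \<le> real p powr (1 / real d)"
        using totient_le[of "p - 1"] by (intro powr_mono2) auto
      also have "real p powr (1 / real d) = t ^ 2"
        using p1 by (simp add: t_def powr_powr flip: powr_realpow)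
      finally have le: "real (totient (p - 1)) powr (1 / real d) \<le> t ^ 2" .
      have "1 / t = t * 1 / t ^ 2" using t0 by (simp add: power2_eq_square)
      also have "\<dots> \<le> t * ln (real p) / real (totient (p - 1)) powr (1 / real d)"
        using ln1 le t0 tot by (intro frac_le mult_left_mono) auto
      finally show ?thesis by simp
    qed
    finally show ?thesis using x unfolding t_def by blast
  qed
  show ?thesis
    by (rule exI[of _ 4], intro conjI exI[of _ "(h ^ 8) ^ (2 * d)"] allI impI) (use main in auto)
qed

end
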